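(* Let $\Omega\subset\mathbb{C}^n$ be a Reinhardt domain such that the origin is a boundary point of $\Omega$. Let $\widehat{\Omega}$ be the smallest (with respect to inclusion) complete log-convex Reinhardt domain in $\mathbb{C}^n$ containing $\Omega$. Then each function in $\mathcal{C}^\infty(\overline{\Omega})\cap\mathcal{O}(\Omega)$ extends holomorphically to $\widehat{\Omega}$; that is, for every $f\in\mathcal{C}^\infty(\overline{\Omega})\cap\mathcal{O}(\Omega)$ there is a holomorphic function $F$ on $\widehat{\Omega}$ with $F|_\Omega=f$.
   Context: A domain in $\mathbb{C}^n$ is a nonempty connected open set. A domain $D\subset\mathbb{C}^n$ is Reinhardt if $(e^{i\theta_1}z_1,\dots,e^{i\theta_n}z_n)\in D$ whenever $(z_1,\dots,z_n)\in D$ and $\theta_1,\dots,\theta_n\in\mathbb{R}$. A Reinhardt domain $D$ is complete if, whenever $w\in D$ and $z\in\mathbb{C}^n$ satisfies $|z_j|\le|w_j|$ for all $j=1,\dots,n$, one has $z\in D$. A Reinhardt domain $D$ is log-convex if the image in $\mathbb{R}^n$ of the set of points of $D$ with all coordinates nonzero under the map $z\mapsto(\log|z_1|,\dots,\log|z_n|)$ is convex. For a domain $\Omega\subset\mathbb{C}^n$, $\mathcal{O}(\Omega)$ is the space of holomorphic functions on $\Omega$, and $\mathcal{C}^\infty(\overline{\Omega})$ is the space of those smooth (complex-valued) functions on $\Omega$ whose partial derivatives of all orders extend continuously to the closure $\overline{\Omega}$ of $\Omega$ in $\mathbb{C}^n$. The domain $\Omega$ is not assumed to be bounded or pseudoconvex.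 *)

theory Defs
  imports "HOL-Complex_Analysis.Complex_Analysis"
begin

section \<open>Reinhardt domains in \<open>\<complex>\<^sup>n\<close>\<close>

definition domain :: "(complex ^ 'n) set \<Rightarrow> bool" where
  "domain D \<longleftrightarrow> open D \<and> connected D \<and> D \<noteq> {}"

definition Reinhardt_domain :: "(complex ^ 'n) set \<Rightarrow> bool" where
  "Reinhardt_domain D \<longleftrightarrow> domain D \<and>
     (\<forall>z\<in>D. \<forall>\<theta> :: real ^ 'n. (\<chi> j. exp (\<i> * complex_of_real (\<theta> $ j)) * z $ j) \<in> D)"

definition complete_Reinhardt_domain :: "(complex ^ 'n) set \<Rightarrow> bool" where
  "complete_Reinhardt_domain D \<longleftrightarrow> Reinhardt_domain D \<and>
     (\<forall>w\<in>D. \<forall>z. (\<forall>j. cmod (z $ j) \<le> cmod (w $ j)) \<longrightarrow> z \<in> D)"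

definition log_image :: "(complex ^ 'n) set \<Rightarrow> (real ^ 'n) set" where
  "log_image D = (\<lambda>z. \<chi> j. ln (cmod (z $ j))) ` {z \<in> D. \<forall>j. z $ j \<noteq> 0}"

definition log_convex :: "(complex ^ 'n) set \<Rightarrow> bool" where
  "log_convex D \<longleftrightarrow> convex (log_image D)"

text \<open>For sets, \<^const>\<open>Least\<close> refers to inclusion.\<close>

definition log_convex_complete_hull :: "(complex ^ 'n) set \<Rightarrow> (complex ^ 'n) set" where
  "log_convex_complete_hull \<Omega> =
     (LEAST D. complete_Reinhardt_domain D \<and> log_convex D \<and> \<Omega> \<subseteq> D)"


section \<open>Holomorphic functions of several variables\<close>

text \<open>Only meant for open sets: the derivative is taken at \<open>z\<close>, not within the set.\<close>

definition holomorphic_Cn :: "(complex ^ 'n \<Rightarrow> complex) \<Rightarrow> (complex ^ 'n) set \<Rightarrow> bool"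
    (infixl "holomorphic'_Cn" 50) where
  "f holomorphic_Cn \<Omega> \<longleftrightarrow>
     (\<forall>z\<in>\<Omega>. \<exists>f'. (f has_derivative f') (at z) \<and> (\<forall>c v. f' (c *s v) = c * f' v))"


section \<open>Smoothness up to the boundary\<close>

text \<open>The directions in \<^const>\<open>Basis\<close> are the real coordinate directions; on
  \<open>\<complex>\<^sup>n\<close> they are the unit vectors and their multiples by \<open>\<i>\<close>. On an open set, the
  partial derivatives do not depend on the values of \<open>f\<close> off that set.\<close>

definition partial_derivative ::
    "'a::euclidean_space \<Rightarrow> ('a \<Rightarrow> 'b::real_normed_vector) \<Rightarrow> 'a \<Rightarrow> 'b" where
  "partial_derivative v f z = vector_derivative (\<lambda>t::real. f (z + t *\<^sub>R v)) (at 0)"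

definition has_partial_derivative_at ::
    "'a::euclidean_space \<Rightarrow> ('a \<Rightarrow> 'b::real_normed_vector) \<Rightarrow> 'a \<Rightarrow> bool" where
  "has_partial_derivative_at v f z \<longleftrightarrow> (\<lambda>t::real. f (z + t *\<^sub>R v)) differentiable (at 0)"

primrec iterated_partial ::
    "'a::euclidean_space list \<Rightarrow> ('a \<Rightarrow> 'b::real_normed_vector) \<Rightarrow> 'a \<Rightarrow> 'b" where
  "iterated_partial [] f = f"
| "iterated_partial (v # vs) f = partial_derivative v (iterated_partial vs f)"

definition smooth_on ::
    "'a::euclidean_space set \<Rightarrow> ('a \<Rightarrow> 'b::real_normed_vector) \<Rightarrow> bool" where
  "smooth_on \<Omega> f \<longleftrightarrow>
     (\<forall>vs\<in>lists Basis. continuous_on \<Omega> (iterated_partial vs f) \<and>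
        (\<forall>v\<in>Basis. \<forall>z\<in>\<Omega>. has_partial_derivative_at v (iterated_partial vs f) z))"

definition smooth_up_to_boundary ::
    "'a::euclidean_space set \<Rightarrow> ('a \<Rightarrow> 'b::real_normed_vector) \<Rightarrow> bool" where
  "smooth_up_to_boundary \<Omega> f \<longleftrightarrow> smooth_on \<Omega> f \<and>
     (\<forall>vs\<in>lists Basis. \<exists>g. continuous_on (closure \<Omega>) g \<and>
        (\<forall>z\<in>\<Omega>. g z = iterated_partial vs f z))"

end

theory Submission
  imports Defs
begin

text \<open>
  On a Reinhardt domain \<open>\<Omega>\<close> a holomorphic function \<open>f\<close> has a Laurent expansion
  whose terms \<open>a\<^sub>\<alpha> * z\<^sup>\<alpha>\<close>, for \<open>\<alpha>\<close> an integer vector, are the Fourier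
  coefficients of \<open>f\<close> on the torus through \<open>z\<close>.  Smoothness up to the boundary
  excludes negative exponents.  Indeed, differentiate \<open>\<alpha>\<^sub>j\<close> times in each direction
  \<open>j\<close> with \<open>\<alpha>\<^sub>j > 0\<close>: the term becomes a nonzero multiple of
  \<open>a\<^sub>\<alpha>\<close> times the product of the powers \<open>z\<^sub>j powi \<alpha>\<^sub>j\<close> with
  \<open>\<alpha>\<^sub>j < 0\<close>, which is unbounded near the boundary point \<open>0\<close> unless
  \<open>a\<^sub>\<alpha> = 0\<close> or no exponent is negative.  But it is a Fourier coefficient of a derivative
  of \<open>f\<close>, and that derivative is bounded near \<open>0\<close>.  So only a power series
  remains.  Its coefficients satisfy the Cauchy estimates at the points of \<open>\<Omega>\<close>, and by
  convexity of the exponential the terms stay bounded over the convex hull of the logarithmic image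
  of \<open>\<Omega>\<close>; hence the series converges to a holomorphic function on the union of the
  corresponding polydiscs, which is the complete log-convex hull.  On \<open>\<Omega>\<close> this function
  has the same Fourier coefficients as \<open>f\<close>, and it agrees with \<open>f\<close>.

  The expansion enters only through its coefficients.  That these have the form \<open>a\<^sub>\<alpha> * z\<^sup>\<alpha>\<close> with one constant for the whole
  domain is \<open>fcoeff_eq_monomial\<close>; it rests on integration by parts over the torus,
  \<open>fcoeff_pd\<close>, which also relates the coefficients of \<open>f\<close> to those of its
  derivatives and so gives the growth bound \<open>fcoeff_bound_near_0\<close>.  The remaining
  pillars are the description of the hull, \<open>log_convex_complete_hull_eq\<close>, and the uniqueness of
  Fourier series, \<open>fourier_uniqueness\<close>.
\<close>

section \<open>Averaging over the torus\<close>

definition upd :: "'a ^ 'n \<Rightarrow> 'n \<Rightarrow> 'a \<Rightarrow> 'a ^ 'n" where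
  "upd z j w = (\<chi> k. if k = j then w else z $ k)"

lemma upd_nth [simp]: "upd z j w $ k = (if k = j then w else z $ k)"
  by (simp add: upd_def)

lemma upd_upd [simp]: "upd (upd z j v) j w = upd z j w"
  and upd_self [simp]: "upd z j (z $ j) = z"
  by (simp_all add: vec_eq_iff)

text \<open>The integral over one period cube, divided by the volume of the cube, is the mean over the torus
  of a function of angles that is \<open>2 * pi\<close>-periodic in each coordinate.  Periodicity is a
  hypothesis of the lemmas on translation invariance.\<close>

definition period_box :: "(real ^ 'n) set" where
  "period_box = cbox 0 (\<chi> j. 2 * pi)"

definition mean :: "(real ^ 'n \<Rightarrow> complex) \<Rightarrow> complex" where
  "mean \<phi> = integral period_box \<phi> /\<^sub>R measure lborel (period_box :: (real ^ 'n) set)"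

lemma measure_period_box: "measure lborel (period_box :: (real ^ 'n) set) > 0"
  unfolding period_box_def content_pos_lt_eq by (auto simp: Basis_vec_def inner_axis)

lemma box_period_box_nonempty: "box 0 (\<chi> j. 2 * pi :: real ^ 'n) \<noteq> {}"
  by (auto simp: box_ne_empty Basis_vec_def inner_axis)

lemma integrable_period_box:
  "continuous_on UNIV \<phi> \<Longrightarrow> \<phi> integrable_on (period_box :: (real ^ 'n) set)"
  for \<phi> :: "real ^ 'n \<Rightarrow> complex"
  unfolding period_box_def by (rule integrable_continuous) (rule continuous_on_subset, auto)

lemma mean_add:
  "continuous_on UNIV \<phi> \<Longrightarrow> continuous_on UNIV \<psi> \<Longrightarrow> mean (\<lambda>\<theta>. \<phi> \<theta> + \<psi> \<theta>) = mean \<phi> + mean \<psi>"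
  unfolding mean_def
  by (subst integral_add) (auto intro: integrable_period_box simp: scaleR_add_right)

lemma mean_cmult: "mean (\<lambda>\<theta>. c * \<phi> \<theta>) = c * mean \<phi>"
  unfolding mean_def by simp

lemma mean_diff:
  "continuous_on UNIV \<phi> \<Longrightarrow> continuous_on UNIV \<psi> \<Longrightarrow> mean (\<lambda>\<theta>. \<phi> \<theta> - \<psi> \<theta>) = mean \<phi> - mean \<psi>"
  unfolding mean_def
  by (subst integral_diff) (auto intro: integrable_period_box simp: scaleR_diff_right)

lemma mean_sum:
  assumes "finite S" "\<And>i. i \<in> S \<Longrightarrow> continuous_on UNIV (\<phi> i)"
  shows "mean (\<lambda>\<theta>. \<Sum>i\<in>S. \<phi> i \<theta>) = (\<Sum>i\<in>S. mean (\<phi> i))"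
  unfolding mean_def using assms
  by (subst integral_sum) (auto intro: integrable_period_box simp: scaleR_sum_right)

lemma mean_const [simp]: "mean (\<lambda>\<theta> :: real ^ 'n. c) = c"
proof -
  have "integral (period_box :: (real ^ 'n) set) (\<lambda>_. c)
      = measure lborel (period_box :: (real ^ 'n) set) *\<^sub>R c"
    unfolding period_box_def by (rule integral_const)
  then show ?thesis
    unfolding mean_def using measure_period_box[where 'n = 'n] by simp
qed

lemma norm_mean_le:
  fixes \<phi> :: "real ^ 'n \<Rightarrow> complex"
  assumes "continuous_on UNIV \<phi>" "\<And>\<theta>. norm (\<phi> \<theta>) \<le> B"
  shows "norm (mean \<phi>) \<le> B"
proof -
  have "0 \<le> B" using assms(2)[of 0] norm_ge_zero order_trans by blast
  then have "norm (integral period_box \<phi>) \<le> B * measure lborel (period_box :: (real ^ 'n) set)"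
    using has_integral_bound[OF _ integrable_integral[OF integrable_period_box[OF assms(1)],
        unfolded period_box_def]] assms(2)
    unfolding period_box_def by blast
  then show ?thesis
    unfolding mean_def using measure_period_box[where 'n = 'n]
    by (simp add: divide_simps mult.commute)
qed

lemma mean_nonneg_eq_0:
  fixes \<phi> :: "real ^ 'n \<Rightarrow> real"
  assumes c: "continuous_on UNIV \<phi>" and nn: "\<And>\<theta>. \<phi> \<theta> \<ge> 0"
    and m: "mean (\<lambda>\<theta>. of_real (\<phi> \<theta>)) = 0"
  shows "\<phi> 0 = 0"
proof -
  have i: "\<phi> integrable_on period_box"
    unfolding period_box_def by (rule integrable_continuous) (rule continuous_on_subset[OF c], auto)
  have "integral period_box (\<lambda>\<theta>. complex_of_real (\<phi> \<theta>)) = of_real (integral period_box \<phi>)"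
    using integral_linear[OF i bounded_linear_of_real] by (simp add: o_def)
  then have "integral period_box \<phi> = 0"
    using m measure_period_box[where 'n = 'n] by (simp add: mean_def)
  then have "(\<phi> has_integral 0) (cbox 0 (\<chi> j. 2 * pi))"
    using i integrable_integral unfolding period_box_def by metis
  then show ?thesis
    by (rule has_integral_0_cbox_imp_0[rotated 2])
      (use nn box_period_box_nonempty in \<open>auto intro: continuous_on_subset[OF c] simp: mem_box_cart\<close>)
qed

text \<open>The period cube shifted by \<open>s\<close> along one axis is cut into two slabs; the slab that sticks
  out is moved back by a full period.  This is the only source of invariance below: it yields the
  orthogonality of characters, integration by parts, and the behaviour of Fourier coefficients
  under rotation of a coordinate.\<close>

lemma mean_translate_axis:
  fixes \<phi> :: "real ^ 'n \<Rightarrow> complex"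
  assumes c: "continuous_on UNIV \<phi>" and per: "\<And>\<theta>. \<phi> (\<theta> + axis j (2 * pi)) = \<phi> \<theta>"
    and s: "0 \<le> s" "s \<le> 2 * pi"
  shows "mean (\<lambda>\<theta>. \<phi> (\<theta> + axis j s)) = mean \<phi>"
proof -
  define slab :: "real \<Rightarrow> real \<Rightarrow> (real ^ 'n) set" where
    "slab a b = cbox (upd 0 j a) (upd (\<chi> j. 2 * pi) j b)" for a b
  have split: "integral (slab a b) \<phi> = integral (slab a t) \<phi> + integral (slab t b) \<phi>"
    if "a \<le> t" "t \<le> b" for a b t
  proof -
    have k: "axis j (1::real) \<in> Basis" by (auto simp: Basis_vec_def)
    have "slab a b \<inter> {x. x \<bullet> axis j 1 \<le> t} = slab a t" "slab a b \<inter> {x. x \<bullet> axis j 1 \<ge> t} = slab t b"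
      using that by (force simp: slab_def mem_box_cart inner_axis split: if_splits)+
    moreover have "\<phi> integrable_on slab a b"
      unfolding slab_def by (rule integrable_continuous) (rule continuous_on_subset[OF c], auto)
    ultimately show ?thesis
      using integral_split[OF _ k, of \<phi> "upd 0 j a" "upd (\<chi> j. 2 * pi) j b" t] by (simp add: slab_def)
  qed
  have shift: "integral (slab a b) (\<lambda>\<theta>. \<phi> (\<theta> + axis j t)) = integral (slab (a + t) (b + t)) \<phi>" for a b t
  proof -
    have "slab a b = cbox (upd 0 j (a + t) - axis j t) (upd (\<chi> j. 2 * pi) j (b + t) - axis j t)"
      unfolding slab_def by (rule arg_cong2[where f = cbox]) (auto simp: vec_eq_iff axis_def)
    then show ?thesis
      using integral_shift_cbox[of "upd 0 j (a + t)" "axis j t" "upd (\<chi> j. 2 * pi) j (b + t)" \<phi>]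
      by (simp add: slab_def)
  qed
  have box: "period_box = slab 0 (2 * pi)"
    unfolding period_box_def slab_def by (rule arg_cong2[where f = cbox]) (auto simp: vec_eq_iff)
  have "integral (slab 0 (2 * pi)) (\<lambda>\<theta>. \<phi> (\<theta> + axis j s)) = integral (slab s (2 * pi + s)) \<phi>"
    by (simp add: shift)
  also have "\<dots> = integral (slab s (2 * pi)) \<phi> + integral (slab (2 * pi) (2 * pi + s)) \<phi>"
    using s by (intro split) auto
  also have "integral (slab (2 * pi) (2 * pi + s)) \<phi> = integral (slab 0 s) \<phi>"
    using shift[of 0 s "2 * pi"] by (simp add: per add.commute)
  also have "integral (slab s (2 * pi)) \<phi> + integral (slab 0 s) \<phi> = integral (slab 0 (2 * pi)) \<phi>"
    using split[of 0 s "2 * pi"] s by (simp add: add.commute)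
  finally show ?thesis by (simp add: mean_def box)
qed

text \<open>Integration by parts on the torus: the mean of a translate does not depend on the shift, so its
  derivative with respect to the shift, computed under the integral, is zero.\<close>

lemma mean_derivative_axis:
  fixes \<phi> D :: "real ^ 'n \<Rightarrow> complex"
  assumes c: "continuous_on UNIV \<phi>" and per: "\<And>\<theta>. \<phi> (\<theta> + axis j (2 * pi)) = \<phi> \<theta>"
    and D: "continuous_on UNIV D"
    and d: "\<And>\<theta> t. ((\<lambda>t. \<phi> (\<theta> + axis j t)) has_vector_derivative D (\<theta> + axis j t)) (at t)"
  shows "mean D = 0"
proof -
  let ?U = "{0..2 * pi}"
  have ca: "continuous_on UNIV (\<lambda>t. axis j t :: real ^ 'n)"
  proof -
    have "axis j t = t *\<^sub>R (axis j 1 :: real ^ 'n)" for t by (simp add: vec_eq_iff axis_def)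
    then have "(\<lambda>t. axis j t) = (\<lambda>t. t *\<^sub>R (axis j 1 :: real ^ 'n))" by (rule ext)
    then show ?thesis by (rule ssubst) (intro continuous_intros)
  qed
  have "((\<lambda>s. integral period_box (\<lambda>\<theta>. \<phi> (\<theta> + axis j s))) has_vector_derivative
      integral period_box (\<lambda>\<theta>. D (\<theta> + axis j 0))) (at 0 within ?U)"
    unfolding period_box_def
  proof (rule leibniz_rule_vector_derivative)
    show "((\<lambda>s. \<phi> (\<theta> + axis j s)) has_vector_derivative D (\<theta> + axis j s)) (at s within ?U)" for s \<theta>
      by (rule has_vector_derivative_at_within[OF d])
    show "(\<lambda>\<theta>. \<phi> (\<theta> + axis j s)) integrable_on cbox 0 (\<chi> j. 2 * pi)" for s
      by (intro integrable_continuous continuous_on_compose2[OF c] continuous_intros) auto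
    show "continuous_on (?U \<times> cbox 0 (\<chi> j. 2 * pi)) (\<lambda>(s, \<theta>). D (\<theta> + axis j s))"
      unfolding split_beta
      by (intro continuous_on_compose2[OF D] continuous_intros continuous_on_compose2[OF ca]) auto
  qed auto
  moreover have "integral period_box (\<lambda>\<theta>. \<phi> (\<theta> + axis j s)) = integral period_box \<phi>" if "s \<in> ?U" for s
    using mean_translate_axis[OF c per, of s] that measure_period_box[where 'n = 'n]
    by (simp add: mean_def)
  ultimately have "((\<lambda>s. integral period_box \<phi>) has_vector_derivative integral period_box D) (at 0 within ?U)"
    by (subst (asm) has_vector_derivative_cong_ev[where g = "\<lambda>s. integral period_box \<phi>"])
      (auto simp: axis_def zero_vec_def[symmetric])
  then have "integral period_box D = 0"
    by (rule vector_derivative_unique_within[rotated])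
      (auto simp: trivial_limit_within islimpt_Icc)
  then show ?thesis by (simp add: mean_def)
qed

section \<open>Fourier series on the torus\<close>

definition character :: "('n::finite \<Rightarrow> int) \<Rightarrow> real ^ 'n \<Rightarrow> complex" where
  "character \<gamma> \<theta> = exp (\<i> * of_real (\<Sum>j\<in>UNIV. of_int (\<gamma> j) * \<theta> $ j))"

lemma continuous_on_character [continuous_intros]: "continuous_on S (character \<gamma>)"
  unfolding character_def by (intro continuous_intros)

lemma norm_character [simp]: "norm (character \<gamma> \<theta>) = 1"
  by (simp add: character_def norm_exp_i_times)

lemma character_mult: "character \<gamma> \<theta> * character \<delta> \<theta> = character (\<lambda>j. \<gamma> j + \<delta> j) \<theta>"
  by (simp add: character_def exp_add[symmetric] sum.distrib algebra_simps)

lemma character_0 [simp]: "character (\<lambda>j. 0) \<theta> = 1"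
  by (simp add: character_def)

lemma sum_axis: "(\<Sum>k\<in>UNIV. of_int (\<gamma> k) * axis j t $ k) = of_int (\<gamma> j) * (t::real)"
  for \<gamma> :: "'n::finite \<Rightarrow> int"
  by (simp add: axis_def if_distrib cong: if_cong)

lemma character_add_axis: "character \<gamma> (\<theta> + axis j t) = exp (\<i> * of_real (of_int (\<gamma> j) * t)) * character \<gamma> \<theta>"
  by (simp add: character_def sum.distrib sum_axis distrib_left exp_add mult.commute del: of_real_mult)

lemma character_periodic: "character \<gamma> (\<theta> + axis j (2 * pi)) = character \<gamma> \<theta>"
proof -
  have "exp (\<i> * of_real (of_int (\<gamma> j) * (2 * pi))) = 1"
    using exp_integer_2pi[of "of_int (\<gamma> j)"] by (simp add: algebra_simps)
  then show ?thesis by (simp add: character_add_axis del: of_real_mult)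
qed

lemma sum_if_eq: "(\<Sum>k\<in>UNIV. of_int (if k = j then c else 0) * \<theta> $ k) = of_int c * \<theta> $ j"
  for \<theta> :: "real ^ 'n"
proof -
  have "(\<Sum>k\<in>UNIV. of_int (if k = j then c else 0) * \<theta> $ k)
      = (\<Sum>k\<in>UNIV. if k = j then of_int c * \<theta> $ k else 0)"
    by (intro sum.cong) auto
  then show ?thesis by simp
qed

text \<open>Multiplication by \<open>exp (\<i> * \<theta>\<^sub>j)\<close> or by its inverse is a shift of Fourier
  indices, because these are themselves characters.\<close>

lemma exp_eq_character: "exp (\<i> * complex_of_real (\<theta> $ j)) = character (\<lambda>k. if k = j then 1 else 0) \<theta>"
  unfolding character_def sum_if_eq by simp

lemma exp_eq_character_inverse:
  "inverse (exp (\<i> * complex_of_real (\<theta> $ j))) = character (\<lambda>k. - (if k = j then 1 else 0)) \<theta>"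
  unfolding exp_eq_character character_def of_int_minus mult_minus_left sum_negf of_real_minus mult_minus_right
    exp_minus ..

text \<open>If \<open>\<gamma>\<^sub>j \<noteq> 0\<close>, a translation by
  \<open>pi / \<bar>\<gamma>\<^sub>j\<bar>\<close> along the axis \<open>j\<close> changes the sign of the
  character and preserves its mean.\<close>

lemma mean_character: "mean (character \<gamma>) = (if \<gamma> = (\<lambda>j. 0) then 1 else 0)"
proof (cases "\<gamma> = (\<lambda>j. 0)")
  case False
  then obtain j where j: "\<gamma> j \<noteq> 0" by auto
  define s where "s = pi / \<bar>of_int (\<gamma> j)\<bar>"
  have s: "0 \<le> s" "s \<le> 2 * pi"
  proof -
    have "1 \<le> \<bar>of_int (\<gamma> j) :: real\<bar>" using j by linarith
    then have "pi / \<bar>of_int (\<gamma> j)\<bar> \<le> pi / 1" by (intro divide_left_mono) auto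
    then show "0 \<le> s" "s \<le> 2 * pi" using pi_ge_zero by (auto simp: s_def simp del: pi_ge_zero)
  qed
  have "of_int (\<gamma> j) * s = pi \<or> of_int (\<gamma> j) * s = - pi"
    using j by (auto simp: s_def abs_if)
  then have e: "exp (\<i> * of_real (of_int (\<gamma> j) * s)) = -1"
    by (metis exp_minus exp_pi_i' inverse_1 inverse_minus_eq mult_minus_right of_real_minus)
  have "mean (\<lambda>\<theta>. character \<gamma> (\<theta> + axis j s)) = mean (character \<gamma>)"
    using s by (intro mean_translate_axis continuous_intros character_periodic)
  then have "- mean (character \<gamma>) = mean (character \<gamma>)"
    by (simp only: character_add_axis e mean_cmult) simp
  then show ?thesis using False by simp
next
  case True
  then have "character \<gamma> = (\<lambda>\<theta>. 1)" by auto
  with True show ?thesis by simp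
qed

definition rot :: "real ^ 'n \<Rightarrow> complex ^ 'n \<Rightarrow> complex ^ 'n" where
  "rot \<theta> z = (\<chi> j. exp (\<i> * complex_of_real (\<theta> $ j)) * z $ j)"

lemma rot_nth [simp]: "rot \<theta> z $ j = exp (\<i> * complex_of_real (\<theta> $ j)) * z $ j"
  by (simp add: rot_def)

lemma rot_0 [simp]: "rot 0 z = z"
  by (simp add: vec_eq_iff)

lemma norm_rot [simp]: "norm (rot \<theta> z) = norm z"
  by (simp add: norm_vec_def norm_mult norm_exp_i_times)

lemma continuous_on_rot [continuous_intros]:
  assumes "continuous_on S f" "continuous_on S g"
  shows "continuous_on S (\<lambda>x. rot (f x) (g x))"
  unfolding rot_def by (intro continuous_on_vec_lambda continuous_intros assms)

lemma rot_periodic: "rot (\<theta> + axis j (2 * pi)) z = rot \<theta> z"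
proof -
  have "exp (\<i> * complex_of_real (\<theta> $ j + 2 * pi)) = exp (\<i> * complex_of_real (\<theta> $ j))"
    by (simp add: distrib_left exp_add mult.commute[of \<i>])
  then show ?thesis by (auto simp: vec_eq_iff axis_def)
qed

lemma compact_torus: "compact (range (\<lambda>\<theta>. rot \<theta> z))"
  for z :: "complex ^ 'n"
proof -
  have "\<exists>\<theta>'\<in>period_box. rot \<theta>' z = rot \<theta> z" for \<theta> :: "real ^ 'n"
  proof -
    have "\<exists>t. 0 \<le> t \<and> t \<le> 2 * pi \<and> exp (\<i> * of_real t) = exp (\<i> * of_real (\<theta> $ j))" for j
      by (rule exI[of _ "Arg2pi (exp (\<i> * of_real (\<theta> $ j)))"])
        (metis Arg2pi complex_norm_eq_1_exp less_imp_le mult_1 norm_exp_i_times of_real_1)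
    then obtain t where "\<forall>j. 0 \<le> t j \<and> t j \<le> 2 * pi \<and> exp (\<i> * of_real (t j)) = exp (\<i> * of_real (\<theta> $ j))"
      by metis
    then show ?thesis
      by (intro bexI[of _ "\<chi> j. t j"]) (auto simp: vec_eq_iff period_box_def mem_box_cart)
  qed
  then have "range (\<lambda>\<theta>. rot \<theta> z) \<subseteq> (\<lambda>\<theta>. rot \<theta> z) ` period_box"
    unfolding subset_iff image_iff by metis
  then have "range (\<lambda>\<theta>. rot \<theta> z) = (\<lambda>\<theta>. rot \<theta> z) ` period_box"
    by (intro equalityI) (assumption, intro image_mono subset_UNIV)
  then show ?thesis
    unfolding period_box_def by (simp add: compact_continuous_image continuous_intros)
qed

text \<open>The real and imaginary parts of a coordinate of \<open>rot \<theta> z\<close> are combinations of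
  two characters.  Multiplying by them shifts Fourier indices, so a function all of whose Fourier
  coefficients vanish keeps this property when it is multiplied by a polynomial.  The statement is
  universal in \<open>h\<close> in order to pass through products of polynomials by induction.\<close>

lemma fourier_shift_polynomial:
  assumes "real_polynomial_function p"
    and "continuous_on UNIV h" and "\<And>\<gamma>. mean (\<lambda>\<theta>. h \<theta> * character \<gamma> \<theta>) = 0"
  shows "mean (\<lambda>\<theta>. h \<theta> * of_real (p (rot \<theta> z)) * character \<gamma> \<theta>) = 0"
  using assms
proof (induction p arbitrary: h \<gamma> rule: real_polynomial_function.induct)
  case (linear p)
  interpret bounded_linear p by fact
  define e where "e j = (\<lambda>k. if k = j then 1 else 0 :: int)" for j :: 'a
  have ce: "exp (\<i> * complex_of_real (\<theta> $ j)) = character (e j) \<theta>"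
    "inverse (exp (\<i> * complex_of_real (\<theta> $ j))) = character (\<lambda>k. - e j k) \<theta>" for \<theta> j
    unfolding e_def by (rule exp_eq_character exp_eq_character_inverse)+
  define a b where "a j = p (axis j (z $ j))" and "b j = p (axis j (\<i> * z $ j))" for j
  define c d where "c j = (of_real (a j) - \<i> * of_real (b j)) / 2"
    and "d j = (of_real (a j) + \<i> * of_real (b j)) / 2" for j
  have px: "complex_of_real (p (rot \<theta> z)) = (\<Sum>j\<in>UNIV. c j * character (e j) \<theta> + d j * character (\<lambda>k. - e j k) \<theta>)" for \<theta>
  proof -
    have "rot \<theta> z = (\<Sum>j\<in>UNIV. cos (\<theta> $ j) *\<^sub>R axis j (z $ j) + sin (\<theta> $ j) *\<^sub>R axis j (\<i> * z $ j))"
      by (simp add: vec_eq_iff axis_def if_distrib exp_Euler cos_of_real sin_of_real scaleR_conv_of_real[where 'a = complex]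
          sum.distrib algebra_simps cong: if_cong)
    then have "p (rot \<theta> z) = (\<Sum>j\<in>UNIV. cos (\<theta> $ j) * a j + sin (\<theta> $ j) * b j)"
      by (simp add: sum add scaleR a_def b_def)
    moreover have "of_real (cos (\<theta> $ j) * a j + sin (\<theta> $ j) * b j)
        = c j * character (e j) \<theta> + d j * character (\<lambda>k. - e j k) \<theta>" for j
    proof -
      have x: "character (e j) \<theta> = of_real (cos (\<theta> $ j)) + \<i> * of_real (sin (\<theta> $ j))"
        "character (\<lambda>k. - e j k) \<theta> = of_real (cos (\<theta> $ j)) - \<i> * of_real (sin (\<theta> $ j))"
        unfolding ce[symmetric] exp_minus[symmetric]
        using exp_Euler[of "\<theta> $ j"] exp_Euler[of "- \<theta> $ j"] by (simp_all add: cos_of_real sin_of_real)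
      show ?thesis unfolding x c_def d_def by (simp add: field_simps)
    qed
    ultimately show ?thesis by simp
  qed
  have "h \<theta> * of_real (p (rot \<theta> z)) * character \<gamma> \<theta> =
      (\<Sum>j\<in>UNIV. c j * (h \<theta> * character (\<lambda>k. e j k + \<gamma> k) \<theta>) + d j * (h \<theta> * character (\<lambda>k. - e j k + \<gamma> k) \<theta>))" for \<theta>
    unfolding px by (simp only: sum_distrib_left sum_distrib_right character_mult[symmetric] distrib_left distrib_right mult_ac)
  moreover have "mean (\<lambda>\<theta>. c j * (h \<theta> * character \<delta> \<theta>) + d j * (h \<theta> * character \<epsilon> \<theta>)) = 0" for j \<delta> \<epsilon>
    by (subst mean_add)
      (use linear.prems in \<open>simp_all only: mean_cmult mult_zero_right add_0, auto intro!: continuous_intros\<close>)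
  ultimately show ?case
    by (simp only:, subst mean_sum) (use linear.prems in \<open>auto intro!: continuous_intros\<close>)
next
  case (const c)
  then show ?case using mean_cmult[of "of_real c" "\<lambda>\<theta>. h \<theta> * character \<gamma> \<theta>"] by (simp add: algebra_simps)
next
  case (add p q)
  have c: "continuous_on UNIV p" if "real_polynomial_function p" for p :: "complex ^ 'a \<Rightarrow> real"
    using that continuous_on_polymonial_function real_polynomial_function_eq by blast
  have "continuous_on UNIV (\<lambda>\<theta>. p (rot \<theta> z))" "continuous_on UNIV (\<lambda>\<theta>. q (rot \<theta> z))"
    using add.hyps by (auto intro!: continuous_on_compose2[OF c] continuous_intros)
  then have "mean (\<lambda>\<theta>. h \<theta> * of_real (p (rot \<theta> z)) * character \<gamma> \<theta> + h \<theta> * of_real (q (rot \<theta> z)) * character \<gamma> \<theta>) = 0"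
    by (subst mean_add) (auto intro!: continuous_intros simp: add)
  then show ?case by (simp add: algebra_simps)
next
  case (mult p q)
  have c: "continuous_on UNIV p" if "real_polynomial_function p" for p :: "complex ^ 'a \<Rightarrow> real"
    using that continuous_on_polymonial_function real_polynomial_function_eq by blast
  have "continuous_on UNIV (\<lambda>\<theta>. h \<theta> * of_real (p (rot \<theta> z)))"
    using mult by (auto intro!: continuous_on_compose2[OF c] continuous_intros)
  from mult.IH(2)[OF this] mult.IH(1)[OF mult.prems] show ?case
    by (simp add: algebra_simps)
qed

text \<open>A function without Fourier coefficients is orthogonal to polynomials, hence, by
  Stone-Weierstrass, to its own real and imaginary parts, and so to itself.\<close>

lemma fourier_uniqueness:
  fixes g :: "complex ^ 'n \<Rightarrow> complex"
  assumes c: "continuous_on (range (\<lambda>\<theta>. rot \<theta> z)) g"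
    and 0: "\<And>\<gamma>. mean (\<lambda>\<theta>. g (rot \<theta> z) * character \<gamma> \<theta>) = 0"
  shows "g z = 0"
proof -
  let ?T = "range (\<lambda>\<theta>. rot \<theta> z)"
  have ch: "continuous_on UNIV (\<lambda>\<theta>. g (rot \<theta> z))"
    by (rule continuous_on_compose2[OF c]) (auto intro!: continuous_intros)
  have T: "compact ?T" by (rule compact_torus)
  obtain B where B: "\<And>w. w \<in> ?T \<Longrightarrow> norm (g w) \<le> B"
    using compact_imp_bounded[OF compact_continuous_image[OF c T]] by (auto simp: bounded_iff)
  have ort: "mean (\<lambda>\<theta>. g (rot \<theta> z) * of_real (r (rot \<theta> z))) = 0" if r: "continuous_on ?T r" for r
  proof -
    have "norm (mean (\<lambda>\<theta>. g (rot \<theta> z) * of_real (r (rot \<theta> z)))) \<le> 0 + e" if "e > 0" for e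
    proof -
      have "B \<ge> 0" using B norm_ge_zero order_trans by blast
      define d where "d = e / (B + 1)"
      have "d > 0" using \<open>e > 0\<close> \<open>B \<ge> 0\<close> by (simp add: d_def)
      then obtain p where p: "real_polynomial_function p" "\<And>w. w \<in> ?T \<Longrightarrow> \<bar>r w - p w\<bar> < d"
        using Stone_Weierstrass_real_polynomial_function[OF T r] by metis
      have cp: "continuous_on UNIV p"
        using p(1) continuous_on_polymonial_function real_polynomial_function_eq by blast
      have 1: "continuous_on UNIV (\<lambda>\<theta>. r (rot \<theta> z))" "continuous_on UNIV (\<lambda>\<theta>. p (rot \<theta> z))"
        by (auto intro!: continuous_on_compose2[OF r] continuous_on_compose2[OF cp] continuous_intros)
      have "mean (\<lambda>\<theta>. g (rot \<theta> z) * of_real (p (rot \<theta> z))) = 0"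
        using fourier_shift_polynomial[OF p(1) ch 0, of z "\<lambda>j. 0"] by simp
      then have "mean (\<lambda>\<theta>. g (rot \<theta> z) * of_real (r (rot \<theta> z))) =
          mean (\<lambda>\<theta>. g (rot \<theta> z) * of_real (r (rot \<theta> z)) - g (rot \<theta> z) * of_real (p (rot \<theta> z)))"
        by (subst mean_diff) (auto intro!: continuous_intros ch 1)
      also have "norm \<dots> \<le> B * d"
      proof (rule norm_mean_le)
        fix \<theta>
        have "norm (g (rot \<theta> z)) * \<bar>r (rot \<theta> z) - p (rot \<theta> z)\<bar> \<le> B * d"
          using B[of "rot \<theta> z"] p(2)[of "rot \<theta> z"] \<open>B \<ge> 0\<close> by (intro mult_mono) auto
        then show "norm (g (rot \<theta> z) * of_real (r (rot \<theta> z)) - g (rot \<theta> z) * of_real (p (rot \<theta> z))) \<le> B * d"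
          by (simp add: right_diff_distrib[symmetric] norm_mult flip: of_real_diff)
      qed (auto intro!: continuous_intros ch 1)
      also have "\<dots> \<le> e" using \<open>B \<ge> 0\<close> \<open>e > 0\<close> by (simp add: d_def field_simps)
      finally show ?thesis by simp
    qed
    then have "norm (mean (\<lambda>\<theta>. g (rot \<theta> z) * of_real (r (rot \<theta> z)))) \<le> 0" by (rule field_le_epsilon)
    then show ?thesis by simp
  qed
  \<comment> \<open>the combination is \<open>g\<close> times its complex conjugate\<close>
  have "mean (\<lambda>\<theta>. g (rot \<theta> z) * of_real (Re (g (rot \<theta> z))) +
      (- \<i>) * (g (rot \<theta> z) * of_real (Im (g (rot \<theta> z))))) = 0"
    unfolding mean_cmult using ort[OF continuous_on_Re[OF c]] ort[OF continuous_on_Im[OF c]]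
      mean_cmult[of "- \<i>" "\<lambda>\<theta>. g (rot \<theta> z) * of_real (Im (g (rot \<theta> z)))"]
    by (subst mean_add) (auto intro!: continuous_intros ch simp del: mult_minus_left)
  moreover have "g w * of_real (Re (g w)) + (- \<i>) * (g w * of_real (Im (g w))) = of_real ((cmod (g w))\<^sup>2)" for w
    by (simp only: complex_eq_iff cmod_power2) (simp add: power2_eq_square)
  ultimately have "mean (\<lambda>\<theta>. of_real ((cmod (g (rot \<theta> z)))\<^sup>2)) = 0" by simp
  then have "(cmod (g (rot 0 z)))\<^sup>2 = 0"
    by (intro mean_nonneg_eq_0) (auto intro!: continuous_intros ch)
  then show ?thesis by simp
qed

section \<open>Reinhardt domains\<close>

lemma exists_rot:
  fixes z w :: "complex ^ 'n"
  assumes "\<And>j. cmod (z $ j) = cmod (w $ j)"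
  shows "\<exists>\<theta>. z = rot \<theta> w"
proof -
  have "\<exists>t. z $ j = exp (\<i> * complex_of_real t) * w $ j" for j
  proof (cases "w $ j = 0")
    case True
    then show ?thesis using assms[of j] by simp
  next
    case False
    then have "cmod (z $ j / w $ j) = 1" using assms[of j] by (simp add: norm_divide)
    then have "exp (\<i> * complex_of_real (Arg2pi (z $ j / w $ j))) = z $ j / w $ j"
      by (rule complex_norm_eq_1_exp[THEN iffD1])
    with False show ?thesis by (metis nonzero_eq_divide_eq)
  qed
  then obtain t where "\<forall>j. z $ j = exp (\<i> * complex_of_real (t j)) * w $ j" by metis
  then have "z = rot (\<chi> j. t j) w" by (simp add: vec_eq_iff)
  then show ?thesis by blast
qed

lemma Reinhardt_open: "Reinhardt_domain \<Omega> \<Longrightarrow> open \<Omega>"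
  and Reinhardt_connected: "Reinhardt_domain \<Omega> \<Longrightarrow> connected \<Omega>"
  by (simp_all add: Reinhardt_domain_def domain_def)

lemma Reinhardt_rot: "Reinhardt_domain \<Omega> \<Longrightarrow> z \<in> \<Omega> \<Longrightarrow> rot \<theta> z \<in> \<Omega>"
  by (simp add: Reinhardt_domain_def rot_def)

lemma Reinhardt_cmod_eq:
  fixes z w :: "complex ^ 'n"
  assumes "Reinhardt_domain \<Omega>" "w \<in> \<Omega>" "\<And>j. cmod (z $ j) = cmod (w $ j)"
  shows "z \<in> \<Omega>"
  using exists_rot[OF assms(3)] Reinhardt_rot[OF assms(1,2)] by auto

text \<open>Used in two ways: it shows that points off the coordinate hyperplanes are dense in an open set,
  and it puts an open set inside the union of the open polydiscs spanned by its own points.\<close>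

lemma exists_larger_moduli:
  fixes z :: "complex ^ 'n"
  assumes "open \<Omega>" "z \<in> \<Omega>" "e > 0"
  shows "\<exists>w\<in>\<Omega>. dist w z < e \<and> (\<forall>j. cmod (z $ j) < cmod (w $ j))"
proof -
  define u :: "complex ^ 'n" where "u = (\<chi> j. if z $ j = 0 then 1 else sgn (z $ j))"
  obtain r where r: "r > 0" "ball z r \<subseteq> \<Omega>" using assms openE by blast
  define d where "d = min e r / (2 * (norm u + 1))"
  have nu: "norm u + 1 > 0" by (simp add: add_nonneg_pos)
  have d: "d > 0" using r assms nu by (simp add: d_def)
  have "d * norm u \<le> d * (norm u + 1)" using d by simp
  also have "\<dots> = min e r / 2" using nu by (simp add: d_def field_simps)
  also have "\<dots> < min e r" using r assms by (simp add: min_def)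
  finally have "dist (z + d *\<^sub>R u) z < min e r" using d by (simp add: dist_norm)
  moreover have "cmod (z $ j) < cmod ((z + d *\<^sub>R u) $ j)" for j
  proof (cases "z $ j = 0")
    case False
    then have "(z + d *\<^sub>R u) $ j = (1 + of_real (d / cmod (z $ j))) * z $ j"
      by (simp add: u_def sgn_div_norm scaleR_conv_of_real[where 'a = complex] field_simps)
    moreover have "cmod (1 + of_real (d / cmod (z $ j))) = 1 + d / cmod (z $ j)"
      using d by (metis abs_of_pos add_pos_nonneg divide_nonneg_nonneg less_imp_le norm_ge_zero
          norm_of_real of_real_1 of_real_add zero_less_one)
    ultimately have "cmod ((z + d *\<^sub>R u) $ j) = (1 + d / cmod (z $ j)) * cmod (z $ j)"
      by (simp only: norm_mult)
    then show ?thesis using False d by (simp add: distrib_right)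
  qed (use d in \<open>simp add: u_def\<close>)
  ultimately show ?thesis
    using r by (intro bexI[of _ "z + d *\<^sub>R u"]) (auto simp: dist_commute)
qed

text \<open>Membership in a Reinhardt domain depends only on the moduli; a point whose moduli are close to
  those of \<open>p\<close> can be rotated to be close to \<open>p\<close> itself.\<close>

lemma Reinhardt_moduli_nhd:
  fixes p :: "complex ^ 'n"
  assumes R: "Reinhardt_domain \<Omega>" and p: "p \<in> \<Omega>"
  shows "\<exists>e>0. \<forall>z. (\<forall>j. \<bar>cmod (z $ j) - cmod (p $ j)\<bar> < e) \<longrightarrow> z \<in> \<Omega>"
proof -
  obtain r where r: "r > 0" "ball p r \<subseteq> \<Omega>" using Reinhardt_open[OF R] p openE by blast
  define e where "e = r / CARD('n)"
  have "z \<in> \<Omega>" if z: "\<And>j. \<bar>cmod (z $ j) - cmod (p $ j)\<bar> < e" for z :: "complex ^ 'n"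
  proof -
    \<comment> \<open>where \<open>p $ j = 0\<close> any direction will do\<close>
    define w :: "complex ^ 'n" where
      "w = (\<chi> j. of_real (cmod (z $ j)) * (if p $ j = 0 then 1 else sgn (p $ j)))"
    have "cmod ((w - p) $ j) < e" for j
    proof (cases "p $ j = 0")
      case False
      then have "(w - p) $ j = of_real (cmod (z $ j) - cmod (p $ j)) * sgn (p $ j)"
        by (simp add: w_def sgn_div_norm scaleR_conv_of_real[where 'a = complex] field_simps)
      then show ?thesis using z[of j] False
        by (simp add: norm_mult norm_sgn del: of_real_diff)
    qed (use z[of j] in \<open>simp add: w_def\<close>)
    then have "(\<Sum>j\<in>UNIV. cmod ((w - p) $ j)) < (\<Sum>j\<in>(UNIV :: 'n set). e)"
      by (intro sum_strict_mono) auto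
    then have "norm (w - p) < r"
      using L2_set_le_sum[of UNIV "\<lambda>j. norm ((w - p) $ j)"]
      by (simp add: e_def norm_vec_def)
    then have "w \<in> \<Omega>" using r by (auto simp: dist_norm norm_minus_commute)
    then show ?thesis
      by (rule Reinhardt_cmod_eq[OF R]) (auto simp: w_def norm_mult norm_sgn)
  qed
  moreover have "e > 0" using r by (simp add: e_def)
  ultimately show ?thesis by blast
qed

section \<open>Separately holomorphic functions\<close>

text \<open>Integration by parts and the differentiation of Fourier coefficients use only continuity and
  holomorphy in each variable separately, and this property passes to continuous partial
  derivatives.\<close>

definition sep_holo :: "(complex ^ 'n \<Rightarrow> complex) \<Rightarrow> (complex ^ 'n) set \<Rightarrow> bool" where
  "sep_holo g \<Omega> \<longleftrightarrow> continuous_on \<Omega> g \<and>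
     (\<forall>z\<in>\<Omega>. \<forall>k. \<exists>d. ((\<lambda>\<zeta>. g (upd z k \<zeta>)) has_field_derivative d) (at (z $ k)))"

abbreviation pd :: "'n \<Rightarrow> (complex ^ 'n \<Rightarrow> complex) \<Rightarrow> complex ^ 'n \<Rightarrow> complex" where
  "pd k \<equiv> partial_derivative (axis k 1)"

lemma sep_holo_continuous: "sep_holo g \<Omega> \<Longrightarrow> continuous_on \<Omega> g"
  by (simp add: sep_holo_def)

lemma upd_conv_axis: "upd z k \<zeta> = z + axis k (\<zeta> - z $ k)" for z :: "complex ^ 'n"
  by (simp add: vec_eq_iff axis_def)

lemma norm_axis [simp]: "norm (axis k x :: complex ^ 'n) = norm x"
  by (simp add: norm_eq_sqrt_inner inner_axis_axis)

lemma bounded_linear_axis: "bounded_linear (axis k :: complex \<Rightarrow> complex ^ 'n)"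
  unfolding linear_conv_bounded_linear[symmetric] by (rule linearI) (auto simp: vec_eq_iff axis_def)

lemma continuous_on_upd [continuous_intros]:
  fixes f :: "_ \<Rightarrow> complex ^ 'n"
  assumes "continuous_on S f" "continuous_on S g"
  shows "continuous_on S (\<lambda>x. upd (f x) k (g x))"
  unfolding upd_conv_axis
  by (intro continuous_intros assms bounded_linear.continuous_on[OF bounded_linear_axis])

lemma sep_holo_has_derivative:
  assumes g: "sep_holo g \<Omega>" and w: "upd z k \<zeta> \<in> \<Omega>"
  shows "((\<lambda>\<zeta>. g (upd z k \<zeta>)) has_field_derivative pd k g (upd z k \<zeta>)) (at \<zeta>)"
proof -
  have "\<exists>d. ((\<lambda>\<xi>. g (upd (upd z k \<zeta>) k \<xi>)) has_field_derivative d) (at (upd z k \<zeta> $ k))"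
    using g w unfolding sep_holo_def by blast
  then obtain d where d: "((\<lambda>\<xi>. g (upd z k \<xi>)) has_field_derivative d) (at \<zeta>)"
    by auto
  have i: "((\<lambda>t. \<zeta> + of_real t) has_vector_derivative 1) (at 0)"
    by (auto intro!: derivative_eq_intros)
  have "(((\<lambda>\<xi>. g (upd z k \<xi>)) \<circ> (\<lambda>t. \<zeta> + of_real t)) has_vector_derivative 1 * d) (at 0)"
    by (rule field_vector_diff_chain_at[OF i]) (simp add: d)
  moreover have "upd z k (\<zeta> + of_real t) = upd z k \<zeta> + t *\<^sub>R axis k 1" for t
    by (simp add: vec_eq_iff axis_def scaleR_conv_of_real[where 'a = complex])
  ultimately have "((\<lambda>t. g (upd z k \<zeta> + t *\<^sub>R axis k 1)) has_vector_derivative d) (at 0)"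
    by (simp add: o_def)
  then have "pd k g (upd z k \<zeta>) = d"
    unfolding partial_derivative_def by (rule vector_derivative_at)
  with d show ?thesis by simp
qed

lemma holomorphic_Cn_imp_sep_holo:
  assumes f: "f holomorphic_Cn \<Omega>"
  shows "sep_holo f \<Omega>"
  unfolding sep_holo_def
proof (intro conjI ballI allI)
  show "continuous_on \<Omega> f"
    unfolding continuous_on_eq_continuous_within
    using f has_derivative_continuous continuous_at_imp_continuous_at_within
    unfolding holomorphic_Cn_def by blast
next
  fix z k assume "z \<in> \<Omega>"
  then obtain f' where f': "(f has_derivative f') (at z)" "\<And>c v. f' (c *s v) = c * f' v"
    using f unfolding holomorphic_Cn_def by blast
  have "((\<lambda>\<zeta>. upd z k \<zeta>) has_derivative axis k) (at (z $ k))"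
    unfolding upd_conv_axis
    by (auto intro!: derivative_eq_intros bounded_linear.has_derivative[OF bounded_linear_axis])
  then have "((\<lambda>\<zeta>. f (upd z k \<zeta>)) has_derivative (\<lambda>h. f' (axis k h))) (at (z $ k))"
    by (rule has_derivative_compose) (simp add: f')
  moreover have "h * f' (axis k 1) = f' (axis k h)" for h
    using f'(2)[of h "axis k 1"] by (simp add: axis_def vector_scalar_mult_def if_distrib cong: if_cong)
  ultimately show "\<exists>d. ((\<lambda>\<zeta>. f (upd z k \<zeta>)) has_field_derivative d) (at (z $ k))"
    by (intro exI[of _ "f' (axis k 1)"] has_derivative_imp_has_field_derivative)
qed

text \<open>The difference quotients in direction \<open>k\<close> are holomorphic in the variable
  \<open>l\<close>, and they converge locally uniformly because the partial derivative is uniformly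
  continuous on compact sets.  The limit is therefore holomorphic, by Weierstrass.\<close>

lemma sep_holo_pd:
  fixes g :: "complex ^ 'n \<Rightarrow> complex"
  assumes op: "open \<Omega>" and g: "sep_holo g \<Omega>" and c: "continuous_on \<Omega> (pd k g)"
  shows "sep_holo (pd k g) \<Omega>"
  unfolding sep_holo_def
proof (intro conjI ballI allI c)
  fix z l assume z: "z \<in> \<Omega>"
  obtain r' where r': "r' > 0" "cball z r' \<subseteq> \<Omega>" using op z open_contains_cball by blast
  define r where "r = r' / 2"
  have r: "r > 0" "r' = r + r" using r' by (simp_all add: r_def)
  define \<delta> where "\<delta> m = complex_of_real (r / (real m + 1))" for m :: nat
  have \<delta>: "\<delta> m \<noteq> 0" "norm (\<delta> m) = r / (real m + 1)" "norm (\<delta> m) \<le> r" for m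
  proof -
    have "real m + 1 > 0" by simp
    then show 1: "norm (\<delta> m) = r / (real m + 1)"
      unfolding \<delta>_def norm_of_real using r by simp
    have "norm (\<delta> m) > 0" unfolding 1 using r by simp
    then show "\<delta> m \<noteq> 0" by auto
    have "r / (real m + 1) \<le> r / 1" using r by (intro divide_left_mono) auto
    then show "norm (\<delta> m) \<le> r" unfolding 1 by simp
  qed
  define q where "q m \<zeta> = (g (upd z l \<zeta> + axis k (\<delta> m)) - g (upd z l \<zeta>)) / \<delta> m" for m \<zeta>
  let ?B = "ball (z $ l) r"
  have in_cball: "upd z l \<zeta> + axis k \<xi> \<in> cball z r'" if "\<zeta> \<in> ?B" "norm \<xi> \<le> r" for \<zeta> \<xi>
  proof -
    have "norm (axis l (\<zeta> - z $ l) + axis k \<xi>) \<le> r + r"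
      using that by (intro order_trans[OF norm_triangle_ineq] add_mono)
        (auto simp: dist_norm norm_minus_commute)
    then show ?thesis
      unfolding upd_conv_axis r(2) mem_cball dist_norm
      by (metis add.assoc add_diff_cancel_left' norm_minus_commute)
  qed
  have u0: "upd z l \<zeta> \<in> cball z r'" if "\<zeta> \<in> ?B" for \<zeta>
  proof -
    have "upd z l \<zeta> + axis k 0 \<in> cball z r'" using in_cball[OF that, of 0] r by simp
    also have "upd z l \<zeta> + axis k 0 = upd z l \<zeta>" by (simp add: vec_eq_iff axis_def)
    finally show ?thesis .
  qed
  have hol: "q m holomorphic_on ?B" for m
    unfolding holomorphic_on_open[OF open_ball]
  proof
    fix \<zeta> assume \<zeta>: "\<zeta> \<in> ?B"
    define a where "a = (if k = l then \<delta> m else 0)"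
    have e: "upd z l \<xi> + axis k (\<delta> m) = upd (z + axis k (\<delta> m)) l (\<xi> + a)" for \<xi>
      by (auto simp: vec_eq_iff a_def axis_def)
    have 1: "((\<lambda>\<xi>. g (upd z l \<xi>)) has_field_derivative pd l g (upd z l \<zeta>)) (at \<zeta>)"
      by (rule sep_holo_has_derivative[OF g]) (use r' u0[OF \<zeta>] in auto)
    have 2: "((\<lambda>\<xi>. g (upd (z + axis k (\<delta> m)) l \<xi>)) has_field_derivative
        pd l g (upd (z + axis k (\<delta> m)) l (\<zeta> + a))) (at (\<zeta> + a))"
      by (rule sep_holo_has_derivative[OF g]) (use r' in_cball[OF \<zeta>] \<delta> in \<open>auto simp: e[symmetric]\<close>)
    have 3: "((\<lambda>\<xi>. g (upd (z + axis k (\<delta> m)) l (\<xi> + a))) has_field_derivative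
        pd l g (upd (z + axis k (\<delta> m)) l (\<zeta> + a))) (at \<zeta>)"
      using 2 by (subst (asm) DERIV_shift)
    show "\<exists>d. (q m has_field_derivative d) (at \<zeta>)"
      unfolding q_def e using DERIV_cdivide[OF DERIV_diff[OF 3 1], of "\<delta> m"] by blast
  qed
  have ul: "uniform_limit ?B q (\<lambda>\<zeta>. pd k g (upd z l \<zeta>)) sequentially"
  proof (rule uniform_limitI)
    fix e :: real assume "e > 0"
    have "uniformly_continuous_on (cball z r') (pd k g)"
      by (rule compact_uniformly_continuous) (use c r' continuous_on_subset in auto)
    then obtain \<eta> where \<eta>: "\<eta> > 0" "\<And>w w'. w \<in> cball z r' \<Longrightarrow> w' \<in> cball z r' \<Longrightarrow> dist w' w < \<eta>
        \<Longrightarrow> dist (pd k g w') (pd k g w) < e / 2"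
      unfolding uniformly_continuous_on_def using half_gt_zero[OF \<open>e > 0\<close>] by metis
    have "(\<lambda>m. r / (real m + 1)) \<longlonglongrightarrow> 0"
      using tendsto_mult[OF tendsto_const[of r] LIMSEQ_inverse_real_of_nat]
      by (simp add: divide_inverse add.commute)
    then have "\<forall>\<^sub>F m in sequentially. r / (real m + 1) < \<eta>"
      using \<eta>(1) by (rule order_tendstoD)
    then show "\<forall>\<^sub>F m in sequentially. \<forall>\<zeta>\<in>?B. dist (q m \<zeta>) (pd k g (upd z l \<zeta>)) < e"
    proof eventually_elim
      case (elim m)
      show ?case
      proof
        fix \<zeta> assume \<zeta>: "\<zeta> \<in> ?B"
        define w where "w = upd z l \<zeta>"
        define \<phi> where "\<phi> \<xi> = g (upd w k \<xi>) - pd k g w * \<xi>" for \<xi>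
        have wd: "upd w k \<xi> \<in> cball z r'" "dist (upd w k \<xi>) w < \<eta>"
          if "\<xi> \<in> cball (w $ k) (norm (\<delta> m))" for \<xi>
          using that in_cball[OF \<zeta>, of "\<xi> - w $ k"] \<delta>[of m] elim unfolding upd_conv_axis[of w]
          by (auto simp: w_def dist_norm norm_minus_commute)
        \<comment> \<open>the mean value inequality for \<open>g\<close> minus its linearization at \<open>w\<close>\<close>
        have "norm (\<phi> (w $ k + \<delta> m) - \<phi> (w $ k)) \<le> (e / 2) * norm (w $ k + \<delta> m - w $ k)"
        proof (rule field_differentiable_bound[where S = "cball (w $ k) (norm (\<delta> m))"])
          fix \<xi> assume \<xi>: "\<xi> \<in> cball (w $ k) (norm (\<delta> m))"
          have "upd w k \<xi> \<in> \<Omega>" using wd[OF \<xi>] r' by auto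
          note d = sep_holo_has_derivative[OF g this]
          show "(\<phi> has_field_derivative pd k g (upd w k \<xi>) - pd k g w)
              (at \<xi> within cball (w $ k) (norm (\<delta> m)))"
            unfolding \<phi>_def by (rule has_field_derivative_at_within[OF DERIV_diff[OF d DERIV_cmult_Id]])
          show "norm (pd k g (upd w k \<xi>) - pd k g w) \<le> e / 2"
            using \<eta>(2)[of w "upd w k \<xi>"] wd[OF \<xi>] u0[OF \<zeta>] by (simp add: w_def dist_norm)
        qed (auto simp: dist_norm)
        also have "upd w k (w $ k + \<delta> m) = w + axis k (\<delta> m)" by (simp add: upd_conv_axis)
        then have "q m \<zeta> * \<delta> m = g (upd w k (w $ k + \<delta> m)) - g w"
          using \<delta>(1)[of m] by (simp add: q_def w_def)
        then have "\<phi> (w $ k + \<delta> m) - \<phi> (w $ k) = (q m \<zeta> - pd k g w) * \<delta> m"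
          unfolding left_diff_distrib by (simp add: \<phi>_def distrib_left)
        finally have "norm (q m \<zeta> - pd k g w) \<le> e / 2"
          using \<delta>(1)[of m] by (simp add: norm_mult)
        then show "dist (q m \<zeta>) (pd k g (upd z l \<zeta>)) < e"
          using \<open>e > 0\<close> by (simp add: w_def dist_norm)
      qed
    qed
  qed
  have "(\<lambda>\<zeta>. pd k g (upd z l \<zeta>)) holomorphic_on ?B"
  proof (rule holomorphic_uniform_sequence[OF open_ball hol])
    fix x assume "x \<in> ?B"
    then obtain d where "d > 0" "cball x d \<subseteq> ?B" using open_ball open_contains_cball by blast
    then show "\<exists>d>0. cball x d \<subseteq> ?B \<and>
        uniform_limit (cball x d) q (\<lambda>\<zeta>. pd k g (upd z l \<zeta>)) sequentially"
      using uniform_limit_on_subset[OF ul] by blast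
  qed
  then show "\<exists>d. ((\<lambda>\<zeta>. pd k g (upd z l \<zeta>)) has_field_derivative d) (at (z $ l))"
    unfolding holomorphic_on_open[OF open_ball] using r by simp
qed

section \<open>Fourier coefficients of functions on a Reinhardt domain\<close>

text \<open>For a monomial this is the monomial itself or zero.  Hence, for holomorphic \<open>g\<close>,
  it is the Laurent term \<open>a\<^sub>\<alpha> * z\<^sup>\<alpha>\<close>.\<close>

definition fcoeff :: "(complex ^ 'n \<Rightarrow> complex) \<Rightarrow> ('n \<Rightarrow> int) \<Rightarrow> complex ^ 'n \<Rightarrow> complex" where
  "fcoeff g \<alpha> z = mean (\<lambda>\<theta>. g (rot \<theta> z) * character (\<lambda>j. - \<alpha> j) \<theta>)"

definition zpow :: "('n::finite \<Rightarrow> int) \<Rightarrow> complex ^ 'n \<Rightarrow> complex" where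
  "zpow \<alpha> z = (\<Prod>j\<in>UNIV. z $ j powi \<alpha> j)"

lemma zpow_upd: "zpow \<alpha> (upd z j w) = w powi \<alpha> j * (\<Prod>k\<in>UNIV - {j}. z $ k powi \<alpha> k)"
  unfolding zpow_def by (subst prod.remove[of _ j]) auto

lemma zpow_split: "zpow \<alpha> z = z $ j powi \<alpha> j * (\<Prod>k\<in>UNIV - {j}. z $ k powi \<alpha> k)"
  using zpow_upd[of \<alpha> z j "z $ j"] by simp

lemma rot_add_axis: "rot (\<theta> + axis j t) z = upd (rot \<theta> z) j (exp (\<i> * of_real (\<theta> $ j + t)) * z $ j)"
  by (simp add: vec_eq_iff axis_def)

lemma rot_upd: "rot \<theta> (upd z j w) = upd (rot \<theta> z) j (exp (\<i> * of_real (\<theta> $ j)) * w)"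
  by (simp add: vec_eq_iff)

lemma rot_upd_exp: "rot \<theta> (upd z j (exp (\<i> * of_real s) * z $ j)) = rot (\<theta> + axis j s) z"
  by (auto simp: vec_eq_iff axis_def distrib_left exp_add)

lemma exp_mult_character: "exp (\<i> * of_real (\<theta> $ j)) * character (\<lambda>k. - \<alpha> k) \<theta> = character (\<lambda>k. - (\<alpha>(j := \<alpha> j - 1)) k) \<theta>"
  unfolding exp_eq_character character_mult by (rule arg_cong2[where f = character]) auto

lemma continuous_on_fcoeff_integrand:
  assumes "Reinhardt_domain \<Omega>" "continuous_on \<Omega> g" "z \<in> \<Omega>"
  shows "continuous_on UNIV (\<lambda>\<theta>. g (rot \<theta> z))"
  by (rule continuous_on_compose2[OF assms(2)])
    (auto intro!: continuous_intros Reinhardt_rot[OF assms(1,3)])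

lemma norm_fcoeff_le:
  assumes "Reinhardt_domain \<Omega>" "continuous_on \<Omega> g" "z \<in> \<Omega>" "\<And>\<theta>. norm (g (rot \<theta> z)) \<le> B"
  shows "norm (fcoeff g \<alpha> z) \<le> B"
  unfolding fcoeff_def
  by (intro norm_mean_le continuous_intros continuous_on_fcoeff_integrand[OF assms(1-3)])
    (simp add: norm_mult assms)

text \<open>Rotating the coordinate \<open>j\<close> of \<open>z\<close> is a translation of the angles.\<close>

lemma fcoeff_rot:
  assumes R: "Reinhardt_domain \<Omega>" and g: "continuous_on \<Omega> g" and z: "z \<in> \<Omega>" and s: "0 \<le> s" "s \<le> 2 * pi"
  shows "fcoeff g \<alpha> (upd z j (exp (\<i> * of_real s) * z $ j)) = exp (\<i> * of_real (of_int (\<alpha> j) * s)) * fcoeff g \<alpha> z"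
proof -
  have "exp (- (\<i> * of_real (of_int (\<alpha> j) * s))) * exp (\<i> * of_real (of_int (\<alpha> j) * s)) = 1"
    by (simp flip: exp_add)
  then have e: "character (\<lambda>k. - \<alpha> k) \<theta> = exp (\<i> * of_real (of_int (\<alpha> j) * s)) * character (\<lambda>k. - \<alpha> k) (\<theta> + axis j s)" for \<theta>
    by (simp add: character_add_axis flip: mult.assoc exp_add)
  have "fcoeff g \<alpha> (upd z j (exp (\<i> * of_real s) * z $ j)) =
      mean (\<lambda>\<theta>. exp (\<i> * of_real (of_int (\<alpha> j) * s)) *
        (g (rot (\<theta> + axis j s) z) * character (\<lambda>k. - \<alpha> k) (\<theta> + axis j s)))"
    unfolding fcoeff_def rot_upd_exp by (subst e) (simp add: mult_ac)
  also have "\<dots> = exp (\<i> * of_real (of_int (\<alpha> j) * s)) * fcoeff g \<alpha> z"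
    unfolding mean_cmult fcoeff_def
    by (subst mean_translate_axis) (auto intro!: continuous_intros continuous_on_fcoeff_integrand[OF R g z]
        simp: s rot_periodic character_periodic)
  finally show ?thesis .
qed

text \<open>Differentiating the Laurent series of \<open>g\<close> termwise would give this relation at once;
  here it comes from integrating by parts in the angle of the coordinate \<open>j\<close>.\<close>

lemma fcoeff_pd:
  assumes R: "Reinhardt_domain \<Omega>" and g: "sep_holo g \<Omega>" and c: "continuous_on \<Omega> (pd j g)" and z: "z \<in> \<Omega>"
  shows "z $ j * fcoeff (pd j g) (\<alpha>(j := \<alpha> j - 1)) z = of_int (\<alpha> j) * fcoeff g \<alpha> z"
proof -
  define \<phi> where "\<phi> \<theta> = g (rot \<theta> z) * character (\<lambda>k. - \<alpha> k) \<theta>" for \<theta>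
  define \<psi> where "\<psi> \<theta> = pd j g (rot \<theta> z) * character (\<lambda>k. - (\<alpha>(j := \<alpha> j - 1)) k) \<theta>" for \<theta>
  have cont: "continuous_on UNIV \<phi>" "continuous_on UNIV \<psi>"
    unfolding \<phi>_def \<psi>_def using continuous_on_fcoeff_integrand[OF R _ z] sep_holo_continuous[OF g] c
    by (auto intro!: continuous_intros)
  have "mean (\<lambda>\<theta>. (\<i> * z $ j) * \<psi> \<theta> + (- \<i> * of_int (\<alpha> j)) * \<phi> \<theta>) = 0"
  proof (rule mean_derivative_axis[where \<phi> = \<phi> and j = j])
    show "\<phi> (\<theta> + axis j (2 * pi)) = \<phi> \<theta>" for \<theta>
      by (simp add: \<phi>_def rot_periodic character_periodic)
    fix \<theta> t
    define u where "u s = exp (\<i> * of_real (\<theta> $ j + s)) * z $ j" for s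
    have u: "(u has_vector_derivative \<i> * u t) (at t)"
    proof -
      have "((\<lambda>w. exp (\<i> * (of_real (\<theta> $ j) + w)) * z $ j) has_field_derivative \<i> * u t) (at (of_real t))"
        by (auto intro!: derivative_eq_intros simp: u_def)
      from has_vector_derivative_real_field[OF this] show ?thesis by (simp add: u_def[abs_def])
    qed
    have ru: "rot (\<theta> + axis j s) z = upd (rot \<theta> z) j (u s)" for s
      by (simp add: rot_add_axis u_def)
    have "upd (rot \<theta> z) j (u t) \<in> \<Omega>" using Reinhardt_rot[OF R z] by (simp flip: ru)
    note d = sep_holo_has_derivative[OF g this]
    have 1: "((\<lambda>s. g (rot (\<theta> + axis j s) z)) has_vector_derivative \<i> * u t * pd j g (rot (\<theta> + axis j t) z)) (at t)"
      using field_vector_diff_chain_at[OF u d] by (simp add: o_def ru)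
    have 2: "((\<lambda>s. character (\<lambda>k. - \<alpha> k) (\<theta> + axis j s)) has_vector_derivative
        - \<i> * of_int (\<alpha> j) * character (\<lambda>k. - \<alpha> k) (\<theta> + axis j t)) (at t)"
    proof -
      have "((\<lambda>w. exp (\<i> * (of_int (- \<alpha> j) * w)) * character (\<lambda>k. - \<alpha> k) \<theta>) has_field_derivative
        - \<i> * of_int (\<alpha> j) * character (\<lambda>k. - \<alpha> k) (\<theta> + axis j t)) (at (of_real t))"
        by (auto intro!: derivative_eq_intros simp: character_add_axis)
      from has_vector_derivative_real_field[OF this] show ?thesis by (simp add: character_add_axis)
    qed
    have e: "u t * character (\<lambda>k. - \<alpha> k) (\<theta> + axis j t)
        = z $ j * character (\<lambda>k. - (\<alpha>(j := \<alpha> j - 1)) k) (\<theta> + axis j t)"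
      using exp_mult_character[of "\<theta> + axis j t" j \<alpha>] by (simp add: u_def mult_ac)
    have "\<i> * z $ j * \<psi> (\<theta> + axis j t) = \<i> * u t * pd j g (rot (\<theta> + axis j t) z) * character (\<lambda>k. - \<alpha> k) (\<theta> + axis j t)"
      using arg_cong[OF e[symmetric], of "\<lambda>x. \<i> * pd j g (rot (\<theta> + axis j t) z) * x"]
      by (simp only: \<psi>_def mult_ac)
    then show "((\<lambda>s. \<phi> (\<theta> + axis j s)) has_vector_derivative
        (\<i> * z $ j) * \<psi> (\<theta> + axis j t) + (- \<i> * of_int (\<alpha> j)) * \<phi> (\<theta> + axis j t)) (at t)"
      using has_vector_derivative_mult[OF 1 2]
      by (simp add: \<phi>_def mult_ac add.commute)
  qed (intro continuous_intros cont)+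
  then have "(\<i> * z $ j) * mean \<psi> + (- \<i> * of_int (\<alpha> j)) * mean \<phi> = 0"
    by (subst (asm) mean_add) (auto intro!: continuous_intros cont simp only: mean_cmult)
  then have "\<i> * (z $ j * mean \<psi> - of_int (\<alpha> j) * mean \<phi>) = 0" by (simp add: algebra_simps)
  then show ?thesis by (simp add: fcoeff_def \<phi>_def[abs_def] \<psi>_def[abs_def])
qed

lemma fcoeff_has_derivative:
  assumes R: "Reinhardt_domain \<Omega>" and g: "sep_holo g \<Omega>" and c: "continuous_on \<Omega> (pd j g)"
    and I: "convex I" "t \<in> I" "\<And>t. t \<in> I \<Longrightarrow> upd z j (of_real t) \<in> \<Omega>"
  shows "((\<lambda>t. fcoeff g \<alpha> (upd z j (of_real t))) has_vector_derivative
    fcoeff (pd j g) (\<alpha>(j := \<alpha> j - 1)) (upd z j (of_real t))) (at t within I)"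
proof -
  have mem: "rot \<theta> (upd z j (of_real t)) \<in> \<Omega>" if "t \<in> I" for \<theta> t
    using that I(3) Reinhardt_rot[OF R] by blast
  have "((\<lambda>t. integral period_box (\<lambda>\<theta>. g (rot \<theta> (upd z j (of_real t))) * character (\<lambda>k. - \<alpha> k) \<theta>))
    has_vector_derivative integral period_box (\<lambda>\<theta>. pd j g (rot \<theta> (upd z j (of_real t))) *
      character (\<lambda>k. - (\<alpha>(j := \<alpha> j - 1)) k) \<theta>)) (at t within I)"
    unfolding period_box_def
  proof (rule leibniz_rule_vector_derivative)
    fix t \<theta> assume t: "t \<in> I"
    define u where "u s = exp (\<i> * of_real (\<theta> $ j)) * of_real s" for s
    have u: "(u has_vector_derivative exp (\<i> * of_real (\<theta> $ j))) (at t)"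
      unfolding u_def by (auto intro!: derivative_eq_intros)
    have "upd (rot \<theta> z) j (u t) \<in> \<Omega>" using mem[OF t] by (simp add: rot_upd u_def)
    note d = sep_holo_has_derivative[OF g this]
    have "((\<lambda>s. g (rot \<theta> (upd z j (of_real s)))) has_vector_derivative
        exp (\<i> * of_real (\<theta> $ j)) * pd j g (rot \<theta> (upd z j (of_real t)))) (at t)"
      using field_vector_diff_chain_at[OF u d] by (simp add: o_def rot_upd u_def)
    then have "((\<lambda>s. g (rot \<theta> (upd z j (of_real s))) * character (\<lambda>k. - \<alpha> k) \<theta>) has_vector_derivative
        exp (\<i> * of_real (\<theta> $ j)) * pd j g (rot \<theta> (upd z j (of_real t))) * character (\<lambda>k. - \<alpha> k) \<theta>) (at t within I)"
      by (rule has_vector_derivative_mult_left[OF has_vector_derivative_at_within])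
    then show "((\<lambda>s. g (rot \<theta> (upd z j (of_real s))) * character (\<lambda>k. - \<alpha> k) \<theta>) has_vector_derivative
        pd j g (rot \<theta> (upd z j (of_real t))) * character (\<lambda>k. - (\<alpha>(j := \<alpha> j - 1)) k) \<theta>) (at t within I)"
      unfolding exp_mult_character[symmetric] by (simp only: mult_ac)
  next
    fix t assume "t \<in> I"
    then show "(\<lambda>\<theta>. g (rot \<theta> (upd z j (of_real t))) * character (\<lambda>k. - \<alpha> k) \<theta>) integrable_on cbox 0 (\<chi> j. 2 * pi)"
      by (intro integrable_continuous continuous_intros continuous_on_subset[OF
            continuous_on_fcoeff_integrand[OF R sep_holo_continuous[OF g] I(3)]]) auto
  next
    show "continuous_on (I \<times> cbox 0 (\<chi> j. 2 * pi)) (\<lambda>(t, \<theta>). pd j g (rot \<theta> (upd z j (of_real t))) *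
      character (\<lambda>k. - (\<alpha>(j := \<alpha> j - 1)) k) \<theta>)"
      unfolding split_beta
      by (intro continuous_intros continuous_on_compose2[OF c] continuous_on_compose2[OF continuous_on_character[of UNIV]])
        (auto intro: mem)
  qed (use I in auto)
  then have "((\<lambda>t. integral period_box (\<lambda>\<theta>. g (rot \<theta> (upd z j (of_real t))) * character (\<lambda>k. - \<alpha> k) \<theta>)
      /\<^sub>R measure lborel (period_box :: (real ^ 'a) set))
    has_vector_derivative integral period_box (\<lambda>\<theta>. pd j g (rot \<theta> (upd z j (of_real t))) *
      character (\<lambda>k. - (\<alpha>(j := \<alpha> j - 1)) k) \<theta>) /\<^sub>R measure lborel (period_box :: (real ^ 'a) set)) (at t within I)"
    by (rule bounded_linear.has_vector_derivative[OF bounded_linear_scaleR_right])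
  then show ?thesis by (simp add: fcoeff_def mean_def)
qed

text \<open>By integration by parts, the coefficient satisfies \<open>t * A' = \<alpha>\<^sub>j * A\<close> along the
  coordinate \<open>j\<close>, the differential equation of \<open>t powi \<alpha>\<^sub>j\<close>.\<close>

lemma fcoeff_slice_real:
  assumes R: "Reinhardt_domain \<Omega>" and g: "sep_holo g \<Omega>" and c: "continuous_on \<Omega> (pd j g)"
    and I: "convex I" "\<And>t. t \<in> I \<Longrightarrow> upd z j (of_real t) \<in> \<Omega> \<and> t > 0"
    and s: "s \<in> I" "t \<in> I"
  shows "fcoeff g \<alpha> (upd z j (of_real s)) / zpow \<alpha> (upd z j (of_real s))
       = fcoeff g \<alpha> (upd z j (of_real t)) / zpow \<alpha> (upd z j (of_real t))"
proof -
  define P where "P = (\<Prod>k\<in>UNIV - {j}. z $ k powi \<alpha> k)"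
  define q where "q t = fcoeff g \<alpha> (upd z j (of_real t)) * of_real t powi (- \<alpha> j)" for t
  have "(q has_vector_derivative 0) (at t within I)" if t: "t \<in> I" for t
  proof -
    let ?A' = "fcoeff (pd j g) (\<alpha>(j := \<alpha> j - 1)) (upd z j (of_real t))"
    let ?A = "fcoeff g \<alpha> (upd z j (of_real t))"
    have t0: "t \<noteq> 0" using I(2)[OF t] by simp
    have e: "of_real t * ?A' = of_int (\<alpha> j) * ?A"
      using fcoeff_pd[OF R g c, of "upd z j (of_real t)" \<alpha>] I(2)[OF t] by simp
    have 1: "((\<lambda>t. fcoeff g \<alpha> (upd z j (of_real t))) has_vector_derivative ?A') (at t within I)"
      using I t by (intro fcoeff_has_derivative[OF R g c]) auto
    have "((\<lambda>w. w powi (- \<alpha> j)) has_field_derivative of_int (- \<alpha> j) * of_real t powi (- \<alpha> j - 1) * 1)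
        (at (complex_of_real t))"
      using t0 by (intro DERIV_power_int DERIV_ident) auto
    then have 2: "((\<lambda>t. complex_of_real t powi (- \<alpha> j)) has_vector_derivative
        of_int (- \<alpha> j) * of_real t powi (- \<alpha> j - 1)) (at t within I)"
      by (intro has_vector_derivative_real_field) simp
    have p: "complex_of_real t powi (- \<alpha> j) = of_real t powi (- \<alpha> j - 1) * of_real t"
      using t0 power_int_add_1[of "complex_of_real t" "- \<alpha> j - 1"] by simp
    have "?A * (of_int (- \<alpha> j) * of_real t powi (- \<alpha> j - 1)) + ?A' * of_real t powi (- \<alpha> j)
        = of_real t powi (- \<alpha> j - 1) * (of_real t * ?A' - of_int (\<alpha> j) * ?A)"
      unfolding p by (simp add: algebra_simps)
    also have "\<dots> = 0" using e by simp
    finally show ?thesis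
      using has_vector_derivative_mult[OF 1 2] unfolding q_def by simp
  qed
  then obtain d where d: "\<And>t. t \<in> I \<Longrightarrow> q t = d"
    using has_vector_derivative_zero_constant[OF I(1)] by metis
  have "fcoeff g \<alpha> (upd z j (of_real t)) / zpow \<alpha> (upd z j (of_real t)) = q t / P" for t
    by (simp add: zpow_upd q_def P_def power_int_minus divide_simps)
  with d s show ?thesis by simp
qed

section \<open>Laurent coefficients: independence of the point, and vanishing\<close>

abbreviation nonzero :: "complex ^ 'n \<Rightarrow> bool" where
  "nonzero z \<equiv> \<forall>j. z $ j \<noteq> 0"

lemma zpow_nonzero: "nonzero z \<Longrightarrow> zpow \<alpha> z \<noteq> 0"
  by (simp add: zpow_def)

lemma fcoeff_quotient_rot:
  assumes R: "Reinhardt_domain \<Omega>" and g: "continuous_on \<Omega> g" and z: "z \<in> \<Omega>" and s: "0 \<le> s" "s \<le> 2 * pi"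
  shows "fcoeff g \<alpha> (upd z j (exp (\<i> * of_real s) * z $ j)) / zpow \<alpha> (upd z j (exp (\<i> * of_real s) * z $ j))
    = fcoeff g \<alpha> z / zpow \<alpha> z"
proof -
  have "exp (\<i> * of_real s) powi \<alpha> j = exp (\<i> * of_real (of_int (\<alpha> j) * s))"
    by (simp add: exp_power_int mult_ac)
  then have "zpow \<alpha> (upd z j (exp (\<i> * of_real s) * z $ j)) = exp (\<i> * of_real (of_int (\<alpha> j) * s)) * zpow \<alpha> z"
    by (simp add: zpow_upd zpow_split[of \<alpha> z j] power_int_mult_distrib del: of_real_mult)
  then show ?thesis
    unfolding fcoeff_rot[OF R g z s] by (simp del: of_real_mult)
qed

text \<open>A nonzero coordinate can be replaced by another nonzero value by rotating it to the positive axis,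
  moving along the positive axis, and rotating again.  Moving radially stays off the hyperplane
  \<open>z $ j = 0\<close>, which an arbitrary path need not do.\<close>

lemma fcoeff_quotient_slice:
  fixes z :: "complex ^ 'n"
  assumes R: "Reinhardt_domain \<Omega>" and g: "sep_holo g \<Omega>" and c: "continuous_on \<Omega> (pd j g)"
    and z: "z $ j \<noteq> 0" and w: "w \<noteq> 0"
    and sl: "\<And>t. t \<in> closed_segment (cmod (z $ j)) (cmod w) \<Longrightarrow> upd z j (of_real t) \<in> \<Omega>"
  shows "fcoeff g \<alpha> (upd z j w) / zpow \<alpha> (upd z j w) = fcoeff g \<alpha> z / zpow \<alpha> z"
proof -
  define q where "q z = fcoeff g \<alpha> z / zpow \<alpha> z" for z
  have rot: "q (upd z j v) = q (upd z j (of_real (cmod v)))" if "upd z j (of_real (cmod v)) \<in> \<Omega>" for v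
  proof -
    have v: "exp (\<i> * of_real (Arg2pi v)) * of_real (cmod v) = v"
      by (metis Arg2pi_eq mult.commute)
    show ?thesis
      using fcoeff_quotient_rot[OF R sep_holo_continuous[OF g] that, of "Arg2pi v" \<alpha> j] Arg2pi[of v] v
      by (simp add: q_def)
  qed
  have "q (upd z j (of_real (cmod (z $ j)))) = q (upd z j (of_real (cmod w)))"
    unfolding q_def
  proof (rule fcoeff_slice_real[OF R g c, where I = "closed_segment (cmod (z $ j)) (cmod w)"])
    show "upd z j (complex_of_real t) \<in> \<Omega> \<and> 0 < t" if "t \<in> closed_segment (cmod (z $ j)) (cmod w)" for t
      using sl[OF that] that z w by (auto simp: closed_segment_eq_real_ivl split: if_splits intro: less_le_trans[rotated])
  qed auto
  then show ?thesis
    using rot[of w] rot[of "z $ j"] sl by (simp add: q_def)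
qed

text \<open>The point \<open>p\<close> may have zero coordinates.  The neighbourhood is given by conditions on
  the single moduli, so one can pass from \<open>z\<close> to \<open>w\<close> inside it by changing one
  coordinate at a time.\<close>

lemma fcoeff_quotient_locally_constant:
  fixes p :: "complex ^ 'n"
  assumes R: "Reinhardt_domain \<Omega>" and g: "sep_holo g \<Omega>" and c: "\<And>j. continuous_on \<Omega> (pd j g)"
    and p: "p \<in> \<Omega>"
  shows "\<exists>T. open T \<and> p \<in> T \<and> (\<forall>z\<in>T. \<forall>w\<in>T. nonzero z \<longrightarrow> nonzero w \<longrightarrow>
    fcoeff g \<alpha> z / zpow \<alpha> z = fcoeff g \<alpha> w / zpow \<alpha> w)"
proof -
  obtain e where e: "e > 0" and N: "\<And>z. (\<forall>j. \<bar>cmod (z $ j) - cmod (p $ j)\<bar> < e) \<Longrightarrow> z \<in> \<Omega>"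
    using Reinhardt_moduli_nhd[OF R p] by blast
  define T where "T = {z :: complex ^ 'n. \<forall>j. \<bar>cmod (z $ j) - cmod (p $ j)\<bar> < e}"
  have "open T"
  proof -
    have "T = (\<Inter>j\<in>UNIV. {z :: complex ^ 'n. \<bar>cmod (z $ j) - cmod (p $ j)\<bar> < e})"
      by (auto simp: T_def)
    then show ?thesis by (auto intro!: open_Collect_less continuous_intros)
  qed
  moreover have "fcoeff g \<alpha> z / zpow \<alpha> z = fcoeff g \<alpha> w / zpow \<alpha> w"
    if zw: "z \<in> T" "w \<in> T" "nonzero z" "nonzero w" for z w
  proof -
    define v where "v S = (\<chi> j. if j \<in> S then w $ j else z $ j)" for S
    have "fcoeff g \<alpha> (v S) / zpow \<alpha> (v S) = fcoeff g \<alpha> z / zpow \<alpha> z" if "finite S" for S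
      using that
    proof induction
      case empty
      then show ?case by (simp add: v_def)
    next
      case (insert j S)
      have v: "v (insert j S) = upd (v S) j (w $ j)" by (auto simp: vec_eq_iff v_def)
      have "fcoeff g \<alpha> (upd (v S) j (w $ j)) / zpow \<alpha> (upd (v S) j (w $ j)) = fcoeff g \<alpha> (v S) / zpow \<alpha> (v S)"
      proof (rule fcoeff_quotient_slice[OF R g c])
        fix t assume t: "t \<in> closed_segment (cmod (v S $ j)) (cmod (w $ j))"
        have "\<bar>cmod (v S $ j) - cmod (p $ j)\<bar> < e" "\<bar>cmod (w $ j) - cmod (p $ j)\<bar> < e"
          using zw by (auto simp: v_def T_def)
        then have "\<bar>cmod (of_real t) - cmod (p $ j)\<bar> < e"
          using t norm_ge_zero[of "v S $ j"] norm_ge_zero[of "w $ j"]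
          unfolding closed_segment_eq_real_ivl norm_of_real by (auto split: if_splits; linarith)
        then show "upd (v S) j (of_real t) \<in> \<Omega>"
          using zw by (intro N) (auto simp: v_def T_def)
      qed (use zw in \<open>auto simp: v_def\<close>)
      then show ?case using insert by (simp add: v)
    qed
    from this[of UNIV] show ?thesis by (simp add: v_def)
  qed
  moreover have "p \<in> T" using e by (simp add: T_def)
  ultimately show ?thesis by blast
qed

text \<open>Local constancy holds near every point of the connected set \<open>\<Omega>\<close>, including those
  on the coordinate hyperplanes, and the complement of the hyperplanes is dense.  These two facts
  make the quotient globally constant on that complement.\<close>

lemma fcoeff_eq_monomial:
  assumes R: "Reinhardt_domain \<Omega>" and g: "sep_holo g \<Omega>" and c: "\<And>j. continuous_on \<Omega> (pd j g)"
  shows "\<exists>a. \<forall>z\<in>\<Omega>. nonzero z \<longrightarrow> fcoeff g \<alpha> z = a * zpow \<alpha> z"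
proof -
  define q where "q z = fcoeff g \<alpha> z / zpow \<alpha> z" for z
  have dense: "\<exists>z\<in>\<Omega>. z \<in> T \<and> nonzero z" if "open T" "a \<in> T" "a \<in> \<Omega>" for T a
  proof -
    have "open (T \<inter> \<Omega>)" "a \<in> T \<inter> \<Omega>" using that Reinhardt_open[OF R] by auto
    from exists_larger_moduli[OF this zero_less_one]
    obtain w where w: "w \<in> T \<inter> \<Omega>" "\<And>j. cmod (a $ j) < cmod (w $ j)" by blast
    have "0 < cmod (w $ j)" for j using le_less_trans[OF norm_ge_zero w(2)] .
    then show ?thesis using w(1) by (intro bexI[of _ w]) auto
  qed
  have "q z = q w" if zw: "z \<in> \<Omega>" "nonzero z" "w \<in> \<Omega>" "nonzero w" for z w
  proof (rule connected_induction[where S = \<Omega> and P = nonzero and a = w and Q = "\<lambda>z. q z = q w"])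
    show "\<exists>z. z \<in> T \<and> nonzero z" if "openin (top_of_set \<Omega>) T" "a \<in> T" for T a
      using that dense unfolding openin_open by blast
    show "\<exists>T. openin (top_of_set \<Omega>) T \<and> a \<in> T \<and>
        (\<forall>x\<in>T. \<forall>y\<in>T. nonzero x \<and> nonzero y \<and> q x = q w \<longrightarrow> q y = q w)" if a: "a \<in> \<Omega>" for a
    proof -
      obtain T where T: "open T" "a \<in> T" "\<forall>x\<in>T. \<forall>y\<in>T. nonzero x \<longrightarrow> nonzero y \<longrightarrow> q x = q y"
        using fcoeff_quotient_locally_constant[OF R g c a, of \<alpha>] unfolding q_def by blast
      have "q y = q w" if "x \<in> T" "y \<in> T" "nonzero x" "nonzero y" "q x = q w" for x y
        using T(3) that by metis
      then show ?thesis
        using a T(1,2) by (intro exI[of _ "\<Omega> \<inter> T"] conjI) (auto simp: openin_open_Int)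
    qed
  qed (use zw Reinhardt_connected[OF R] in auto)
  then have "\<exists>a. \<forall>z\<in>\<Omega>. nonzero z \<longrightarrow> q z = a" by metis
  then show ?thesis by (auto simp: q_def zpow_nonzero field_simps)
qed

text \<open>Each exponent \<open>\<alpha>\<^sub>j > 0\<close> is reduced to zero by differentiating
  \<open>\<alpha>\<^sub>j\<close> times in direction \<open>j\<close>, and each derivative contributes a factor
  \<open>\<bar>z\<^sub>j\<bar>\<close>.  The derivative reached in the end is bounded near the origin.  The
  set \<open>P\<close> stands for the family of all iterated partial derivatives of one function.\<close>

lemma fcoeff_bound_near_0:
  fixes \<Omega> :: "(complex ^ 'n) set"
  assumes R: "Reinhardt_domain \<Omega>"
    and sep: "\<And>g. g \<in> P \<Longrightarrow> sep_holo g \<Omega>" and pd: "\<And>g j. g \<in> P \<Longrightarrow> pd j g \<in> P"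
    and bd: "\<And>g. g \<in> P \<Longrightarrow> \<exists>\<delta>>0. \<exists>B. \<forall>z\<in>\<Omega>. norm z < \<delta> \<longrightarrow> norm (g z) \<le> B"
    and g: "g \<in> P"
  shows "\<exists>\<delta>>0. \<exists>B. \<forall>z\<in>\<Omega>. norm z < \<delta> \<longrightarrow> norm (fcoeff g \<alpha> z) \<le> B * (\<Prod>j\<in>UNIV. norm (z $ j) ^ nat (\<alpha> j))"
  using g
proof (induction "\<Sum>j\<in>UNIV. nat (\<alpha> j)" arbitrary: g \<alpha>)
  case 0
  obtain \<delta> B where d: "\<delta> > 0" "\<forall>z\<in>\<Omega>. norm z < \<delta> \<longrightarrow> norm (g z) \<le> B" using bd[OF 0(2)] by blast
  have "norm (fcoeff g \<alpha> z) \<le> B" if "z \<in> \<Omega>" "norm z < \<delta>" for z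
    using that d Reinhardt_rot[OF R]
    by (intro norm_fcoeff_le[OF R sep_holo_continuous[OF sep[OF 0(2)]]]) auto
  moreover have "nat (\<alpha> j) = 0" for j using 0(1) by (metis UNIV_I finite_UNIV_class.finite_UNIV sum_eq_0_iff finite)
  ultimately show ?case using d by auto
next
  case (Suc m)
  have "\<exists>j. nat (\<alpha> j) \<noteq> 0" using Suc.hyps(2) by (metis Suc_neq_Zero sum.neutral)
  then obtain j where j: "\<alpha> j > 0" by (auto simp: not_le)
  define \<beta> where "\<beta> = \<alpha>(j := \<alpha> j - 1)"
  have sp: "(\<Sum>k\<in>UNIV. nat (\<gamma> k)) = nat (\<gamma> j) + (\<Sum>k\<in>UNIV - {j}. nat (\<gamma> k))" for \<gamma> :: "'n \<Rightarrow> int"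
    by (rule sum.remove) auto
  have "(\<Sum>k\<in>UNIV - {j}. nat (\<beta> k)) = (\<Sum>k\<in>UNIV - {j}. nat (\<alpha> k))"
    by (intro sum.cong) (auto simp: \<beta>_def)
  then have "m = (\<Sum>k\<in>UNIV. nat (\<beta> k))"
    using Suc.hyps(2) j unfolding sp[of \<alpha>] sp[of \<beta>] by (simp add: \<beta>_def)
  from Suc.hyps(1)[OF this pd[OF Suc.prems]] obtain \<delta> B where d: "\<delta> > 0"
    "\<forall>z\<in>\<Omega>. norm z < \<delta> \<longrightarrow> norm (fcoeff (pd j g) \<beta> z) \<le> B * (\<Prod>k\<in>UNIV. norm (z $ k) ^ nat (\<beta> k))" by blast
  have "norm (fcoeff g \<alpha> z) \<le> B * (\<Prod>k\<in>UNIV. norm (z $ k) ^ nat (\<alpha> k))" if z: "z \<in> \<Omega>" "norm z < \<delta>" for z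
  proof -
    have pr: "(\<Prod>k\<in>UNIV. norm (z $ k) ^ nat (\<gamma> k)) =
        norm (z $ j) ^ nat (\<gamma> j) * (\<Prod>k\<in>UNIV - {j}. norm (z $ k) ^ nat (\<gamma> k))" for \<gamma> :: "'n \<Rightarrow> int"
      by (rule prod.remove) auto
    have "(\<Prod>k\<in>UNIV - {j}. norm (z $ k) ^ nat (\<beta> k)) = (\<Prod>k\<in>UNIV - {j}. norm (z $ k) ^ nat (\<alpha> k))"
      by (intro prod.cong) (auto simp: \<beta>_def)
    moreover have "nat (\<alpha> j) = Suc (nat (\<beta> j))" using j by (simp add: \<beta>_def)
    ultimately have e: "norm (z $ j) * (\<Prod>k\<in>UNIV. norm (z $ k) ^ nat (\<beta> k)) = (\<Prod>k\<in>UNIV. norm (z $ k) ^ nat (\<alpha> k))"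
      unfolding pr[of \<alpha>] pr[of \<beta>] by simp
    have "norm (fcoeff g \<alpha> z) \<le> of_int (\<alpha> j) * norm (fcoeff g \<alpha> z)"
      using j mult_right_mono[of 1 "of_int (\<alpha> j)" "norm (fcoeff g \<alpha> z)"] by simp
    also have "\<dots> = norm (z $ j * fcoeff (pd j g) \<beta> z)"
      using fcoeff_pd[OF R sep[OF Suc.prems] sep_holo_continuous[OF sep[OF pd[OF Suc.prems]]] z(1), of j \<alpha>] j
      by (simp add: \<beta>_def norm_mult)
    also have "\<dots> \<le> norm (z $ j) * (B * (\<Prod>k\<in>UNIV. norm (z $ k) ^ nat (\<beta> k)))"
      using d z by (simp add: norm_mult mult_left_mono)
    also have "\<dots> = B * (\<Prod>k\<in>UNIV. norm (z $ k) ^ nat (\<alpha> k))" by (simp flip: e)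
    finally show ?thesis .
  qed
  then show ?case using d by blast
qed

lemma norm_zpow_split:
  fixes z :: "complex ^ 'n"
  assumes "nonzero z"
  shows "(\<Prod>j\<in>UNIV. norm (z $ j) ^ nat (\<alpha> j)) = norm (zpow \<alpha> z) * (\<Prod>j\<in>UNIV. norm (z $ j) ^ nat (- \<alpha> j))"
  unfolding zpow_def prod_norm[symmetric] prod.distrib[symmetric]
proof (rule prod.cong)
  fix j
  have "norm (z $ j) powi (int (nat (\<alpha> j))) = norm (z $ j) powi (\<alpha> j + int (nat (- \<alpha> j)))"
    by (rule arg_cong[where f = "\<lambda>n. norm (z $ j) powi n"]) auto
  also have "\<dots> = norm (z $ j) powi \<alpha> j * norm (z $ j) powi (int (nat (- \<alpha> j)))"
    using assms by (intro power_int_add) auto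
  finally show "norm (z $ j) ^ nat (\<alpha> j) = norm (z $ j powi \<alpha> j) * norm (z $ j) ^ nat (- \<alpha> j)"
    by (simp only: power_int_of_nat norm_power_int)
qed auto

text \<open>After cancelling the positive powers, the bound reads
  \<open>\<bar>a\<bar> \<le> B * \<Prod>\<bar>z\<^sub>j\<bar> ^ nat (- \<alpha>\<^sub>j)\<close>, whose right-hand side tends to zero as
  \<open>z\<close> tends to the origin.\<close>

lemma monomial_coefficient_eq_0:
  fixes \<Omega> :: "(complex ^ 'n) set"
  assumes op: "open \<Omega>" and 0: "0 \<in> closure \<Omega>" and \<delta>: "\<delta> > 0"
    and le: "\<And>z. z \<in> \<Omega> \<Longrightarrow> norm z < \<delta> \<Longrightarrow> nonzero z \<Longrightarrow>
      norm (a * zpow \<alpha> z) \<le> B * (\<Prod>j\<in>UNIV. norm (z $ j) ^ nat (\<alpha> j))"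
    and neg: "\<alpha> j0 < 0"
  shows "a = 0"
proof (rule ccontr)
  assume "a \<noteq> 0"
  define \<epsilon> where "\<epsilon> = min (min \<delta> 1) (norm a / (\<bar>B\<bar> + 1))"
  have "\<epsilon> > 0" using \<delta> \<open>a \<noteq> 0\<close> by (simp add: \<epsilon>_def add_nonneg_pos)
  then obtain y where y: "y \<in> \<Omega>" "dist y 0 < \<epsilon> / 2"
    using 0 unfolding closure_approachable by (metis half_gt_zero)
  then obtain z where z: "z \<in> \<Omega>" "dist z y < \<epsilon> / 2" "\<And>j. cmod (y $ j) < cmod (z $ j)"
    using exists_larger_moduli[OF op y(1), of "\<epsilon> / 2"] \<open>\<epsilon> > 0\<close> by auto
  have "0 < cmod (z $ j)" for j using le_less_trans[OF norm_ge_zero z(3)] .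
  then have nz: "nonzero z" by auto
  have "norm z < \<epsilon>" using y z dist_triangle_half_r[of y z \<epsilon> 0] by (simp add: dist_commute)
  then have nrm: "norm z < \<delta>" "norm z < 1" "norm z * (\<bar>B\<bar> + 1) < norm a"
    by (simp_all add: \<epsilon>_def pos_less_divide_eq add_nonneg_pos)
  let ?P = "\<Prod>j\<in>UNIV. norm (z $ j) ^ nat (- \<alpha> j)"
  have lt1: "norm (z $ j) \<le> 1" for j using Finite_Cartesian_Product.norm_nth_le[of z j] nrm by linarith
  have "?P = norm (z $ j0) ^ nat (- \<alpha> j0) * (\<Prod>j\<in>UNIV - {j0}. norm (z $ j) ^ nat (- \<alpha> j))"
    by (rule prod.remove) auto
  also have "\<dots> \<le> norm (z $ j0) ^ 1 * 1"
    using neg lt1 by (intro mult_mono power_decreasing prod_le_1 prod_nonneg) (auto simp: power_le_one)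
  also have "\<dots> \<le> norm z" by (simp add: Finite_Cartesian_Product.norm_nth_le)
  finally have P: "?P \<le> norm z" .
  have "norm a * norm (zpow \<alpha> z) \<le> B * (norm (zpow \<alpha> z) * ?P)"
    using le[OF z(1) nrm(1) nz] by (simp only: norm_mult norm_zpow_split[OF nz, of \<alpha>])
  then have "norm a * norm (zpow \<alpha> z) \<le> (B * ?P) * norm (zpow \<alpha> z)" by (simp add: mult_ac)
  then have "norm a \<le> B * ?P" using zpow_nonzero[OF nz, of \<alpha>] by simp
  also have "\<dots> \<le> (\<bar>B\<bar> + 1) * norm z"
    using P by (intro mult_mono) (auto intro!: prod_nonneg)
  finally show False using nrm(3) by (simp add: mult.commute)
qed

section \<open>The complete log-convex hull\<close>

lemma subset_hull_polydiscs:
  fixes \<Omega> :: "(complex ^ 'n) set"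
  assumes "open \<Omega>"
  shows "\<Omega> \<subseteq> {z. \<exists>x\<in>convex hull log_image \<Omega>. \<forall>j. cmod (z $ j) < exp (x $ j)}" (is "_ \<subseteq> ?D")
proof
  fix z assume "z \<in> \<Omega>"
  from exists_larger_moduli[OF assms this zero_less_one]
  obtain w where w: "w \<in> \<Omega>" "\<And>j. cmod (z $ j) < cmod (w $ j)" by blast
  have pos: "0 < cmod (w $ j)" for j using le_less_trans[OF norm_ge_zero w(2)] .
  then have "(\<chi> j. ln (cmod (w $ j))) \<in> log_image \<Omega>"
    using w(1) by (auto simp: log_image_def)
  then have "(\<chi> j. ln (cmod (w $ j))) \<in> convex hull log_image \<Omega>" by (rule hull_inc)
  then show "z \<in> ?D" using w(2) pos by (intro CollectI bexI) auto
qed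

text \<open>The candidate is a union of polydiscs centred at the origin, hence open and starlike; its
  logarithmic image is the convex hull plus the open negative orthant.  The strict inequality makes
  openness immediate and loses nothing, because \<open>\<Omega>\<close> is open.\<close>

lemma log_convex_complete_hull_eq:
  fixes \<Omega> :: "(complex ^ 'n) set"
  assumes R: "Reinhardt_domain \<Omega>"
  shows "log_convex_complete_hull \<Omega> = {z. \<exists>x\<in>convex hull log_image \<Omega>. \<forall>j. cmod (z $ j) < exp (x $ j)}"
    (is "_ = ?D")
  unfolding log_convex_complete_hull_def
proof (rule Least_equality)
  let ?L = "convex hull log_image \<Omega>"
  have sub: "\<Omega> \<subseteq> ?D" by (rule subset_hull_polydiscs[OF Reinhardt_open[OF R]])
  have op: "open ?D"
  proof -
    have "?D = (\<Union>x\<in>?L. \<Inter>j\<in>UNIV. {z. cmod (z $ j) < exp (x $ j)})" by auto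
    then show ?thesis by (auto intro!: open_Collect_less continuous_intros)
  qed
  have dom: "z \<in> ?D" if "w \<in> ?D" "\<And>j. cmod (z $ j) \<le> cmod (w $ j)" for z w :: "complex ^ 'n"
    using that by (auto intro: le_less_trans)
  have "\<Omega> \<noteq> {}" using R by (simp add: Reinhardt_domain_def domain_def)
  then have ne: "?D \<noteq> {}" using sub by (metis subset_empty)
  have "starlike ?D"
    unfolding starlike_def
  proof (rule bexI[of _ 0], intro ballI subsetI)
    fix z y assume z: "z \<in> ?D" and "y \<in> closed_segment 0 z"
    then obtain u where u: "0 \<le> u" "u \<le> 1" "y = u *\<^sub>R z" by (auto simp: in_segment)
    show "y \<in> ?D" by (rule dom[OF z]) (use u in \<open>auto intro: mult_left_le_one_le\<close>)
  next
    show "0 \<in> ?D" using ne dom[of _ 0] by auto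
  qed
  then have con: "connected ?D" by (rule starlike_imp_connected)
  have comp: "complete_Reinhardt_domain ?D"
    unfolding complete_Reinhardt_domain_def Reinhardt_domain_def domain_def
  proof (intro conjI op con ne ballI allI impI)
    fix z and \<theta> :: "real ^ 'n" assume "z \<in> ?D"
    then show "(\<chi> j. exp (\<i> * complex_of_real (\<theta> $ j)) * z $ j) \<in> ?D"
      by (rule dom) (simp add: norm_mult)
  qed (rule dom, auto)
  have li: "log_image ?D = {y. \<exists>x\<in>?L. \<forall>j. y $ j < x $ j}"
  proof (intro equalityI subsetI)
    fix y assume "y \<in> log_image ?D"
    then obtain z :: "complex ^ 'n" where z: "z \<in> ?D" "\<forall>j. z $ j \<noteq> 0" "y = (\<chi> j. ln (cmod (z $ j)))"
      by (auto simp: log_image_def)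
    then obtain x where x: "x \<in> ?L" "\<And>j. cmod (z $ j) < exp (x $ j)" by auto
    have "ln (cmod (z $ j)) < x $ j" for j
      using x(2)[of j] z(2) by (metis exp_gt_zero ln_exp ln_less_cancel_iff zero_less_norm_iff)
    then show "y \<in> {y. \<exists>x\<in>?L. \<forall>j. y $ j < x $ j}" using x(1) z(3) by auto
  next
    fix y assume "y \<in> {y. \<exists>x\<in>?L. \<forall>j. y $ j < x $ j}"
    then have "(\<chi> j. of_real (exp (y $ j))) \<in> {z \<in> ?D. \<forall>j. z $ j \<noteq> 0}" by auto
    moreover have "y = (\<chi> j. ln (cmod ((\<chi> j. of_real (exp (y $ j))) $ j)))"
      by (simp add: vec_eq_iff)
    ultimately show "y \<in> log_image ?D" unfolding log_image_def by (rule rev_image_eqI)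
  qed
  have "convex (log_image ?D)"
    unfolding li
  proof (rule convexI)
    fix y y' :: "real ^ 'n" and u v :: real
    assume "y \<in> {y. \<exists>x\<in>?L. \<forall>j. y $ j < x $ j}" "y' \<in> {y. \<exists>x\<in>?L. \<forall>j. y $ j < x $ j}"
      and uv: "0 \<le> u" "0 \<le> v" "u + v = 1"
    then obtain x x' where x: "x \<in> ?L" "x' \<in> ?L" "\<And>j. y $ j < x $ j" "\<And>j. y' $ j < x' $ j" by blast
    have "u *\<^sub>R x + v *\<^sub>R x' \<in> ?L" by (rule convexD[OF convex_convex_hull]) (use x uv in auto)
    moreover have "(u *\<^sub>R y + v *\<^sub>R y') $ j < (u *\<^sub>R x + v *\<^sub>R x') $ j" for j
    proof (cases "u = 0")
      case False
      then have "u * y $ j < u * x $ j" using x(3)[of j] uv by simp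
      moreover have "v * y' $ j \<le> v * x' $ j" using x(4)[of j] uv by (simp add: mult_left_mono)
      ultimately show ?thesis by simp
    qed (use x(4) uv in simp)
    ultimately show "u *\<^sub>R y + v *\<^sub>R y' \<in> {y. \<exists>x\<in>?L. \<forall>j. y $ j < x $ j}" by blast
  qed
  then show "complete_Reinhardt_domain ?D \<and> log_convex ?D \<and> \<Omega> \<subseteq> ?D"
    using comp sub by (simp add: log_convex_def)
next
  fix D' assume D': "complete_Reinhardt_domain D' \<and> log_convex D' \<and> \<Omega> \<subseteq> D'"
  then have "log_image \<Omega> \<subseteq> log_image D'" by (auto simp: log_image_def)
  then have sub: "convex hull log_image \<Omega> \<subseteq> log_image D'"
    using D' by (intro hull_minimal) (auto simp: log_convex_def)
  show "?D \<subseteq> D'"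
  proof
    fix z assume "z \<in> ?D"
    then obtain x where x: "x \<in> log_image D'" "\<And>j. cmod (z $ j) < exp (x $ j)" using sub by blast
    then obtain w :: "complex ^ 'n" where w: "w \<in> D'" "\<And>j. w $ j \<noteq> 0" "x = (\<chi> j. ln (cmod (w $ j)))"
      by (auto simp: log_image_def)
    then have "cmod (z $ j) \<le> cmod (w $ j)" for j
      using x(2)[of j] by simp
    then show "z \<in> D'" using D' w(1) by (auto simp: complete_Reinhardt_domain_def)
  qed
qed

section \<open>Power series in several variables\<close>

text \<open>The Weierstrass test, with one summable majorant for the terms and for their derivatives: the
  derived series then converges uniformly as well, and the series may be differentiated termwise.\<close>

lemma holomorphic_Cn_suminf:
  assumes U: "open U" "convex U"
    and d: "\<And>i z. z \<in> U \<Longrightarrow> (f i has_derivative f' i z) (at z)"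
    and lin: "\<And>i z c v. f' i z (c *s v) = c * f' i z v"
    and b: "\<And>i z. z \<in> U \<Longrightarrow> norm (f i z) \<le> b i" "\<And>i z h. z \<in> U \<Longrightarrow> norm (f' i z h) \<le> b i * norm h"
    and sb: "summable b"
  shows "(\<lambda>z. \<Sum>i. f i z) holomorphic_Cn U"
  unfolding holomorphic_Cn_def
proof
  fix z assume z: "z \<in> U"
  define g' where "g' z h = (\<Sum>i. f' i z h)" for z h
  have sf': "summable (\<lambda>i. f' i z h)" if "z \<in> U" for z h
    by (rule summable_comparison_test'[OF summable_mult2[OF sb, of "norm h"]]) (use b(2)[OF that] in auto)
  have sf: "summable (\<lambda>i. f i z)"
    by (rule summable_comparison_test'[OF sb]) (use b(1)[OF z] in auto)
  have "\<exists>g. \<forall>x\<in>U. (\<lambda>n. f n x) sums g x \<and> (g has_derivative g' x) (at x within U)"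
  proof (rule has_derivative_series[where f = f and f' = f' and g' = g', OF U(2) _ _ z summable_sums[OF sf]])
    show "(f n has_derivative f' n x) (at x within U)" if "x \<in> U" for n x
      by (rule has_derivative_at_withinI[OF d[OF that]])
    fix e :: real assume "e > 0"
    have "(\<lambda>n. suminf b - (\<Sum>i<n. b i)) \<longlonglongrightarrow> suminf b - suminf b"
      by (intro tendsto_intros summable_LIMSEQ sb)
    then have "\<forall>\<^sub>F n in sequentially. suminf b - (\<Sum>i<n. b i) < e"
      using \<open>e > 0\<close> by (intro order_tendstoD) auto
    then show "\<forall>\<^sub>F n in sequentially. \<forall>x\<in>U. \<forall>h. norm ((\<Sum>i<n. f' i x h) - g' x h) \<le> e * norm h"
    proof eventually_elim
      case (elim n)
      show ?case
      proof (intro ballI allI)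
        fix x h assume x: "x \<in> U"
        have "norm ((\<Sum>i<n. f' i x h) - g' x h) = norm (\<Sum>i. f' (i + n) x h)"
          unfolding g'_def by (subst suminf_minus_initial_segment[OF sf'[OF x]]) (rule norm_minus_commute)
        also have "\<dots> \<le> (\<Sum>i. b (i + n) * norm h)"
          by (intro norm_suminf_le b x summable_mult2 summable_ignore_initial_segment sb)
        also have "\<dots> = (suminf b - (\<Sum>i<n. b i)) * norm h"
          by (subst suminf_mult2[OF summable_ignore_initial_segment[OF sb], symmetric])
            (simp add: suminf_minus_initial_segment[OF sb])
        also have "\<dots> \<le> e * norm h" using elim by (intro mult_right_mono) auto
        finally show "norm ((\<Sum>i<n. f' i x h) - g' x h) \<le> e * norm h" .
      qed
    qed
  qed
  then obtain g where g: "\<And>x. x \<in> U \<Longrightarrow> (\<lambda>n. f n x) sums g x" "\<And>x. x \<in> U \<Longrightarrow> (g has_derivative g' x) (at x within U)"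
    by blast
  have "((\<lambda>z. \<Sum>i. f i z) has_derivative g' z) (at z)"
    by (rule has_derivative_transform_within_open[OF g(2)[OF z, unfolded at_within_open[OF z U(1)]] U(1) z])
      (use g(1) sums_unique in blast)
  moreover have "g' z (c *s v) = c * g' z v" for c v
    unfolding g'_def lin by (rule suminf_mult[OF sf'[OF z]])
  ultimately show "\<exists>f'. ((\<lambda>z. \<Sum>i. f i z) has_derivative f') (at z) \<and> (\<forall>c v. f' (c *s v) = c * f' v)"
    by blast
qed

definition zpow_deriv :: "('n::finite \<Rightarrow> nat) \<Rightarrow> complex ^ 'n \<Rightarrow> complex ^ 'n \<Rightarrow> complex" where
  "zpow_deriv \<beta> z h = (\<Sum>i\<in>UNIV. of_nat (\<beta> i) * h $ i * z $ i ^ (\<beta> i - 1) * (\<Prod>j\<in>UNIV - {i}. z $ j ^ \<beta> j))"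

lemma zpow_of_nat: "zpow (\<lambda>j. int (\<beta> j)) z = (\<Prod>j\<in>UNIV. z $ j ^ \<beta> j)"
  by (simp add: zpow_def)

lemma zpow_has_derivative: "(zpow (\<lambda>j. int (\<beta> j)) has_derivative zpow_deriv \<beta> z) (at z)"
proof -
  have "((\<lambda>z :: complex ^ 'a. z $ i ^ \<beta> i) has_derivative (\<lambda>h. of_nat (\<beta> i) * h $ i * z $ i ^ (\<beta> i - 1))) (at z)" for i
    by (rule has_derivative_power) (rule bounded_linear.has_derivative[OF bounded_linear_vec_nth has_derivative_ident])
  then show ?thesis
    unfolding zpow_of_nat[abs_def] zpow_deriv_def[abs_def] by (intro has_derivative_prod) auto
qed

lemma zpow_deriv_linear: "zpow_deriv \<beta> z (c *s v) = c * zpow_deriv \<beta> z v"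
  by (simp add: zpow_deriv_def sum_distrib_left mult_ac)

text \<open>The factor \<open>Suc (\<beta> j)\<close> makes room for the exponent that a derivative brings down,
  so that one weight dominates both a monomial and its derivative on a smaller polydisc.\<close>

definition weight :: "real \<Rightarrow> ('n::finite \<Rightarrow> nat) \<Rightarrow> real" where
  "weight \<rho> \<beta> = (\<Prod>j\<in>UNIV. real (Suc (\<beta> j)) * \<rho> ^ \<beta> j)"

lemma weight_nonneg: "0 \<le> \<rho> \<Longrightarrow> 0 \<le> weight \<rho> \<beta>"
  unfolding weight_def by (intro prod_nonneg) simp

text \<open>A finite set of multi-indices lies in a cube, and over a cube the sum factors into a product of
  partial sums of a convergent one-dimensional series.\<close>

lemma summable_weight:
  fixes e :: "nat \<Rightarrow> 'n::finite \<Rightarrow> nat"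
  assumes e: "inj e" and \<rho>: "0 \<le> \<rho>" "\<rho> < 1"
  shows "summable (\<lambda>i. weight \<rho> (e i))"
proof (rule bounded_imp_summable)
  let ?q = "\<lambda>k. real (Suc k) * \<rho> ^ k"
  have q: "summable ?q" using geometric_deriv_sums[of \<rho>] \<rho> by (simp add: sums_iff)
  fix n
  define N where "N = Max ((\<lambda>(i, j). e i j) ` ({..n} \<times> UNIV))"
  have N: "e i j \<le> N" if "i \<le> n" for i j
    unfolding N_def using that by (intro Max_ge) (auto intro!: rev_image_eqI[of "(i, j)"])
  have "(\<Sum>i\<le>n. weight \<rho> (e i)) = (\<Sum>\<beta>\<in>e ` {..n}. weight \<rho> \<beta>)"
    using e by (subst sum.reindex) (auto intro: inj_on_subset simp: o_def)
  also have "\<dots> \<le> (\<Sum>\<beta>\<in>PiE (UNIV :: 'n set) (\<lambda>_. {..N}). weight \<rho> \<beta>)"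
    by (intro sum_mono2 finite_PiE) (use N \<rho> in \<open>auto simp: weight_nonneg PiE_def\<close>)
  also have "\<dots> = (\<Prod>j\<in>(UNIV :: 'n set). \<Sum>k\<le>N. ?q k)"
    unfolding weight_def by (subst prod_sum_PiE) auto
  also have "\<dots> \<le> (\<Prod>j\<in>(UNIV :: 'n set). suminf ?q)"
    using q \<rho> by (intro prod_mono conjI sum_nonneg sum_le_suminf) auto
  finally show "(\<Sum>i\<le>n. weight \<rho> (e i)) \<le> (\<Prod>j\<in>(UNIV :: 'n set). suminf ?q)" .
qed (use \<rho> weight_nonneg in auto)

lemma norm_zpow_le:
  fixes z :: "complex ^ 'n"
  assumes \<rho>: "0 < \<rho>" and R: "\<And>j. R j > 0" and z: "\<And>j. norm (z $ j) \<le> \<rho> * R j"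
  shows "norm (zpow (\<lambda>j. int (\<beta> j)) z) \<le> (\<Prod>j\<in>UNIV. R j ^ \<beta> j) * weight \<rho> \<beta>"
proof -
  have "norm (zpow (\<lambda>j. int (\<beta> j)) z) \<le> (\<Prod>j\<in>UNIV. R j ^ \<beta> j * (real (Suc (\<beta> j)) * \<rho> ^ \<beta> j))"
    unfolding zpow_of_nat prod_norm[symmetric]
  proof (intro prod_mono conjI)
    fix j
    have "norm (z $ j) ^ \<beta> j \<le> (\<rho> * R j) ^ \<beta> j" using z by (intro power_mono) auto
    also have "\<dots> \<le> real (Suc (\<beta> j)) * (\<rho> * R j) ^ \<beta> j"
      using \<rho> R[of j] mult_right_mono[of 1 "real (Suc (\<beta> j))" "(\<rho> * R j) ^ \<beta> j"] by simp
    finally show "norm (z $ j ^ \<beta> j) \<le> R j ^ \<beta> j * (real (Suc (\<beta> j)) * \<rho> ^ \<beta> j)"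
      by (simp add: norm_power power_mult_distrib mult_ac)
  qed auto
  then show ?thesis by (simp add: weight_def prod.distrib)
qed

lemma norm_zpow_deriv_le:
  fixes z :: "complex ^ 'n"
  assumes \<rho>: "0 < \<rho>" and R: "\<And>j. R j > 0" and z: "\<And>j. norm (z $ j) \<le> \<rho> * R j"
  shows "norm (zpow_deriv \<beta> z h) \<le> (\<Sum>i\<in>UNIV. 1 / (\<rho> * R i)) * ((\<Prod>j\<in>UNIV. R j ^ \<beta> j) * weight \<rho> \<beta>) * norm h"
proof -
  define q where "q j = real (Suc (\<beta> j)) * (\<rho> * R j) ^ \<beta> j" for j
  have pos: "\<rho> * R j > 0" for j using \<rho> R by simp
  have Q: "(\<Prod>j\<in>UNIV. q j) = (\<Prod>j\<in>UNIV. R j ^ \<beta> j) * weight \<rho> \<beta>"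
    unfolding weight_def prod.distrib[symmetric] q_def by (intro prod.cong) (auto simp: power_mult_distrib)
  have 1: "norm (z $ j) ^ \<beta> j \<le> q j" for j
  proof -
    have "norm (z $ j) ^ \<beta> j \<le> (\<rho> * R j) ^ \<beta> j" using z by (intro power_mono) auto
    also have "\<dots> \<le> q j" using pos[of j] mult_right_mono[of 1 "real (Suc (\<beta> j))" "(\<rho> * R j) ^ \<beta> j"]
      by (simp add: q_def)
    finally show ?thesis .
  qed
  have 2: "real (\<beta> j) * norm (z $ j) ^ (\<beta> j - 1) \<le> 1 / (\<rho> * R j) * q j" for j
  proof (cases "\<beta> j")
    case (Suc k)
    have "norm (z $ j) ^ k \<le> (\<rho> * R j) ^ k" using z by (intro power_mono) auto
    then have "real (\<beta> j) * norm (z $ j) ^ k \<le> real (Suc (\<beta> j)) * (\<rho> * R j) ^ k"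
      by (intro mult_mono) auto
    also have "\<dots> = 1 / (\<rho> * R j) * q j" using \<rho> R[of j] Suc by (simp add: q_def)
    finally show ?thesis using Suc by simp
  qed (use pos[of j] in \<open>simp add: q_def\<close>)
  have "norm (zpow_deriv \<beta> z h) \<le> (\<Sum>i\<in>UNIV. 1 / (\<rho> * R i) * (\<Prod>j\<in>UNIV. q j) * norm h)"
    unfolding zpow_deriv_def
  proof (rule sum_norm_le)
    fix i
    have "norm (of_nat (\<beta> i) * h $ i * z $ i ^ (\<beta> i - 1) * (\<Prod>j\<in>UNIV - {i}. z $ j ^ \<beta> j))
        = (real (\<beta> i) * norm (z $ i) ^ (\<beta> i - 1)) * (\<Prod>j\<in>UNIV - {i}. norm (z $ j) ^ \<beta> j) * norm (h $ i)"
      by (simp add: norm_mult norm_power mult_ac flip: prod_norm)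
    also have "\<dots> \<le> (1 / (\<rho> * R i) * q i) * (\<Prod>j\<in>UNIV - {i}. q j) * norm h"
    proof (rule mult_mono[OF mult_mono[OF 2 prod_mono] Finite_Cartesian_Product.norm_nth_le])
      have q0: "0 \<le> q j" for j using pos[of j] by (simp add: q_def)
      show nn: "0 \<le> 1 / (\<rho> * R i) * q i" using q0[of i] pos[of i] by simp
      show "0 \<le> 1 / (\<rho> * R i) * q i * (\<Prod>j\<in>UNIV - {i}. q j)"
        by (rule mult_nonneg_nonneg[OF nn prod_nonneg[OF q0]])
    qed (auto intro!: 1 prod_nonneg)
    also have "\<dots> = 1 / (\<rho> * R i) * (\<Prod>j\<in>UNIV. q j) * norm h"
      by (subst prod.remove[of UNIV i q]) (auto simp: mult_ac)
    finally show "norm (of_nat (\<beta> i) * h $ i * z $ i ^ (\<beta> i - 1) * (\<Prod>j\<in>UNIV - {i}. z $ j ^ \<beta> j))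
        \<le> 1 / (\<rho> * R i) * (\<Prod>j\<in>UNIV. q j) * norm h" .
  qed
  then show ?thesis unfolding Q by (simp add: sum_distrib_right)
qed

lemma power_series_majorant:
  fixes e :: "nat \<Rightarrow> 'n::finite \<Rightarrow> nat" and c :: "('n \<Rightarrow> nat) \<Rightarrow> complex"
  assumes e: "inj e" and \<rho>: "0 < \<rho>" "\<rho> < 1" and R: "\<And>j. R j > 0"
    and M: "\<And>\<beta>. norm (c \<beta>) * (\<Prod>j\<in>UNIV. R j ^ \<beta> j) \<le> M"
  shows "\<exists>b. summable b \<and> (\<forall>i z. (\<forall>j. norm (z $ j) \<le> \<rho> * R j) \<longrightarrow>
    norm (c (e i) * zpow (\<lambda>j. int (e i j)) z) \<le> b i \<and>
    (\<forall>h. norm (c (e i) * zpow_deriv (e i) z h) \<le> b i * norm h))"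
proof -
  define K where "K = 1 + (\<Sum>i\<in>UNIV. 1 / (\<rho> * R i))"
  define b where "b i = K * M * weight \<rho> (e i)" for i
  have "0 \<le> 1 / (\<rho> * R i)" for i using \<rho>(1) R[of i] by simp
  then have "(\<Sum>i\<in>UNIV. 1 / (\<rho> * R i)) \<ge> 0" by (rule sum_nonneg)
  then have K: "K \<ge> 1" "(\<Sum>i\<in>UNIV. 1 / (\<rho> * R i)) \<le> K" "(\<Sum>i\<in>UNIV. 1 / (\<rho> * R i)) \<ge> 0"
    by (simp_all add: K_def)
  have M0: "M \<ge> 0" using M[of "\<lambda>_. 0"] by (simp add: order_trans[OF norm_ge_zero])
  have w: "weight \<rho> \<beta> \<ge> 0" for \<beta> :: "'n \<Rightarrow> nat" using \<rho> by (intro weight_nonneg) auto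
  have "norm (c (e i) * zpow (\<lambda>j. int (e i j)) z) \<le> b i \<and>
    (\<forall>h. norm (c (e i) * zpow_deriv (e i) z h) \<le> b i * norm h)" if z: "\<forall>j. norm (z $ j) \<le> \<rho> * R j" for i z
  proof (intro conjI allI)
    have "norm (c (e i) * zpow (\<lambda>j. int (e i j)) z) \<le> norm (c (e i)) * ((\<Prod>j\<in>UNIV. R j ^ e i j) * weight \<rho> (e i))"
      unfolding norm_mult using z by (intro mult_left_mono norm_zpow_le \<rho> R) auto
    also have "\<dots> = (norm (c (e i)) * (\<Prod>j\<in>UNIV. R j ^ e i j)) * weight \<rho> (e i)" by (simp add: mult_ac)
    also have "\<dots> \<le> M * weight \<rho> (e i)" by (intro mult_right_mono M w)
    also have "\<dots> \<le> b i" using K(1) M0 w[of "e i"] mult_right_mono[of 1 K "M * weight \<rho> (e i)"]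
      by (simp add: b_def mult_ac)
    finally show "norm (c (e i) * zpow (\<lambda>j. int (e i j)) z) \<le> b i" .
    fix h
    have "norm (c (e i) * zpow_deriv (e i) z h) \<le> norm (c (e i)) *
        ((\<Sum>i\<in>UNIV. 1 / (\<rho> * R i)) * ((\<Prod>j\<in>UNIV. R j ^ e i j) * weight \<rho> (e i)) * norm h)"
      unfolding norm_mult using z by (intro mult_left_mono norm_zpow_deriv_le \<rho> R) auto
    also have "\<dots> = (\<Sum>i\<in>UNIV. 1 / (\<rho> * R i)) * (norm (c (e i)) * (\<Prod>j\<in>UNIV. R j ^ e i j)) * (weight \<rho> (e i) * norm h)"
      by (simp only: mult_ac)
    also have "\<dots> \<le> K * M * (weight \<rho> (e i) * norm h)"
      using R by (intro mult_right_mono mult_mono M K mult_nonneg_nonneg w prod_nonneg)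
        (use K M0 R in \<open>auto simp: less_imp_le\<close>)
    finally show "norm (c (e i) * zpow_deriv (e i) z h) \<le> b i * norm h" by (simp add: b_def mult_ac)
  qed
  moreover have "summable b"
    unfolding b_def using e \<rho> by (intro summable_mult summable_weight) auto
  ultimately show ?thesis by blast
qed

section \<open>Extension by the Taylor series\<close>

text \<open>The logarithmic form of Abel's lemma: since \<open>exp\<close> is convex, the points
  \<open>x\<close> at which the terms \<open>c \<beta> * exp (\<Sum>\<beta>\<^sub>j * x\<^sub>j)\<close> are bounded form
  a convex set.\<close>

lemma coefficient_bound_hull:
  fixes \<Omega> :: "(complex ^ 'n) set" and c :: "('n \<Rightarrow> nat) \<Rightarrow> complex" and x :: "real ^ 'n"
  assumes b: "\<And>z. z \<in> \<Omega> \<Longrightarrow> nonzero z \<Longrightarrow> \<exists>M. \<forall>\<beta>. norm (c \<beta> * zpow (\<lambda>j. int (\<beta> j)) z) \<le> M"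
    and x: "x \<in> convex hull log_image \<Omega>"
  shows "\<exists>M. \<forall>\<beta>. norm (c \<beta>) * (\<Prod>j\<in>UNIV. exp (x $ j) ^ \<beta> j) \<le> M"
proof -
  define l where "l \<beta> x = (\<Sum>j\<in>UNIV. real (\<beta> j) * x $ j)" for \<beta> :: "'n \<Rightarrow> nat" and x :: "real ^ 'n"
  have exp_l: "(\<Prod>j\<in>UNIV. exp (x $ j) ^ \<beta> j) = exp (l \<beta> x)" for \<beta> and x :: "real ^ 'n"
    by (simp add: l_def exp_sum exp_of_nat_mult)
  define B where "B = {x. \<exists>M. \<forall>\<beta>. norm (c \<beta>) * exp (l \<beta> x) \<le> M}"
  have "log_image \<Omega> \<subseteq> B"
  proof
    fix x assume "x \<in> log_image \<Omega>"
    then obtain z :: "complex ^ 'n" where z: "z \<in> \<Omega>" "\<forall>j. z $ j \<noteq> 0" "x = (\<chi> j. ln (cmod (z $ j)))"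
      by (auto simp: log_image_def)
    have "norm (zpow (\<lambda>j. int (\<beta> j)) z) = exp (l \<beta> x)" for \<beta>
      unfolding exp_l[symmetric] zpow_of_nat prod_norm[symmetric] norm_power using z by simp
    then show "x \<in> B" using b[OF z(1,2)] by (simp add: B_def norm_mult)
  qed
  moreover have "convex B"
  proof (rule convexI)
    fix x y and u v :: real assume "x \<in> B" "y \<in> B" and uv: "0 \<le> u" "0 \<le> v" "u + v = 1"
    then obtain M N where M: "\<And>\<beta>. norm (c \<beta>) * exp (l \<beta> x) \<le> M" and N: "\<And>\<beta>. norm (c \<beta>) * exp (l \<beta> y) \<le> N"
      by (auto simp: B_def)
    have "norm (c \<beta>) * exp (l \<beta> (u *\<^sub>R x + v *\<^sub>R y)) \<le> u * M + v * N" for \<beta>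
    proof -
      have "l \<beta> (u *\<^sub>R x + v *\<^sub>R y) = u * l \<beta> x + v * l \<beta> y"
        by (simp add: l_def sum_distrib_left sum.distrib algebra_simps)
      moreover have "exp (u * l \<beta> x + v * l \<beta> y) \<le> u * exp (l \<beta> x) + v * exp (l \<beta> y)"
        using exp_convex uv unfolding convex_on_def by simp
      ultimately have "norm (c \<beta>) * exp (l \<beta> (u *\<^sub>R x + v *\<^sub>R y))
          \<le> norm (c \<beta>) * (u * exp (l \<beta> x) + v * exp (l \<beta> y))"
        by (simp add: mult_left_mono)
      also have "\<dots> = u * (norm (c \<beta>) * exp (l \<beta> x)) + v * (norm (c \<beta>) * exp (l \<beta> y))"
        by (simp add: algebra_simps)
      also have "\<dots> \<le> u * M + v * N" by (intro add_mono mult_left_mono M N uv)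
      finally show ?thesis .
    qed
    then show "u *\<^sub>R x + v *\<^sub>R y \<in> B" by (auto simp: B_def)
  qed
  ultimately have "convex hull log_image \<Omega> \<subseteq> B" by (rule hull_minimal)
  then show ?thesis using x by (auto simp: B_def exp_l)
qed

lemma zpow_rot: "zpow \<alpha> (rot \<theta> z) = character \<alpha> \<theta> * zpow \<alpha> z"
proof -
  have "character \<alpha> \<theta> = (\<Prod>j\<in>UNIV. exp (\<i> * complex_of_real (\<theta> $ j)) powi \<alpha> j)"
    by (simp add: character_def exp_power_int exp_sum[symmetric] sum_distrib_left mult_ac)
  then show ?thesis by (simp add: zpow_def power_int_mult_distrib prod.distrib)
qed

lemma polydisc_between:
  fixes z :: "complex ^ 'n"
  assumes "\<And>j. norm (z $ j) < R j"
  shows "\<exists>\<rho>. 0 < \<rho> \<and> \<rho> < 1 \<and> (\<forall>j. norm (z $ j) < \<rho> * R j)"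
proof -
  define m where "m = Max (range (\<lambda>j. norm (z $ j) / R j))"
  have R: "R j > 0" for j using le_less_trans[OF norm_ge_zero assms] .
  have m: "norm (z $ j) / R j \<le> m" for j unfolding m_def by (intro Max_ge) auto
  have "m \<in> range (\<lambda>j. norm (z $ j) / R j)" unfolding m_def by (intro Max_in) auto
  then have "0 \<le> m" "m < 1" using assms R by (auto simp: less_imp_le)
  moreover have "norm (z $ j) < (m + 1) / 2 * R j" for j
  proof -
    have "norm (z $ j) \<le> m * R j" using m[of j] R[of j] by (simp add: divide_simps)
    also have "\<dots> < (m + 1) / 2 * R j" using \<open>m < 1\<close> R[of j] by (intro mult_strict_right_mono) auto
    finally show ?thesis .
  qed
  ultimately show ?thesis by (intro exI[of _ "(m + 1) / 2"]) auto
qed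

lemma power_series_holomorphic:
  fixes e :: "nat \<Rightarrow> 'n::finite \<Rightarrow> nat" and X :: "(real ^ 'n) set"
  assumes e: "inj e"
    and M: "\<And>x. x \<in> X \<Longrightarrow> \<exists>M. \<forall>\<beta>. norm (c \<beta>) * (\<Prod>j\<in>UNIV. exp (x $ j) ^ \<beta> j) \<le> M"
  shows "(\<lambda>z. \<Sum>i. c (e i) * zpow (\<lambda>j. int (e i j)) z) holomorphic_Cn
    {z. \<exists>x\<in>X. \<forall>j. cmod (z $ j) < exp (x $ j)}"
proof -
  let ?F = "\<lambda>z. \<Sum>i. c (e i) * zpow (\<lambda>j. int (e i j)) z"
  have "\<exists>U. z \<in> U \<and> ?F holomorphic_Cn U"
    if x: "x \<in> X" and z: "\<And>j. cmod (z $ j) < exp (x $ j)" for z :: "complex ^ 'n" and x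
  proof -
    obtain \<rho> where \<rho>: "0 < \<rho>" "\<rho> < 1" "\<And>j. norm (z $ j) < \<rho> * exp (x $ j)"
      using polydisc_between[of z "\<lambda>j. exp (x $ j)", OF z] by blast
    define U where "U = {w :: complex ^ 'n. \<forall>j. cmod (w $ j) < \<rho> * exp (x $ j)}"
    obtain M where "\<And>\<beta>. norm (c \<beta>) * (\<Prod>j\<in>UNIV. exp (x $ j) ^ \<beta> j) \<le> M" using M[OF x] by blast
    from power_series_majorant[where R = "\<lambda>j. exp (x $ j)", OF e \<rho>(1,2) exp_gt_zero this]
    obtain b where b: "summable b" "\<And>i z. (\<forall>j. norm (z $ j) \<le> \<rho> * exp (x $ j)) \<Longrightarrow>
      norm (c (e i) * zpow (\<lambda>j. int (e i j)) z) \<le> b i \<and>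
      (\<forall>h. norm (c (e i) * zpow_deriv (e i) z h) \<le> b i * norm h)" by blast
    have U: "U = (\<Inter>j\<in>UNIV. (\<lambda>w. w $ j) -` ball 0 (\<rho> * exp (x $ j)))" by (auto simp: U_def)
    have "open U" unfolding U by (auto intro!: open_vimage continuous_intros)
    moreover have "convex U" unfolding U
      by (intro convex_INT ballI convex_linear_vimage bounded_linear.linear bounded_linear_vec_nth convex_ball)
    ultimately have "?F holomorphic_Cn U"
    proof (rule holomorphic_Cn_suminf[where f' = "\<lambda>i z h. c (e i) * zpow_deriv (e i) z h" and b = b])
      show "((\<lambda>z. c (e i) * zpow (\<lambda>j. int (e i j)) z) has_derivative (\<lambda>h. c (e i) * zpow_deriv (e i) z h)) (at z)"
        for i z by (rule has_derivative_mult_right[OF zpow_has_derivative])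
    qed (use b in \<open>auto simp: U_def zpow_deriv_linear less_imp_le\<close>)
    moreover have "z \<in> U" using \<rho>(3) by (simp add: U_def)
    ultimately show ?thesis by blast
  qed
  then show ?thesis unfolding holomorphic_Cn_def by blast
qed

text \<open>Uniform convergence on the torus lets the mean be taken term by term, and
  orthogonality removes every term except possibly one.\<close>

lemma fcoeff_power_series:
  fixes e :: "nat \<Rightarrow> 'n::finite \<Rightarrow> nat" and z :: "complex ^ 'n"
  assumes e: "inj e" and sb: "summable b"
    and b: "\<And>i w. (\<And>j. norm (w $ j) = norm (z $ j)) \<Longrightarrow> norm (c (e i) * zpow (\<lambda>j. int (e i j)) w) \<le> b i"
    and cont: "continuous_on UNIV (\<lambda>\<theta>. \<Sum>i. c (e i) * zpow (\<lambda>j. int (e i j)) (rot \<theta> z))"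
  shows "(\<lambda>i. if (\<lambda>j. int (e i j)) = \<alpha> then c (e i) * zpow \<alpha> z else 0) sums
    fcoeff (\<lambda>w. \<Sum>i. c (e i) * zpow (\<lambda>j. int (e i j)) w) \<alpha> z"
    (is "?t sums fcoeff ?F \<alpha> z")
proof -
  let ?s = "\<lambda>i \<theta>. c (e i) * zpow (\<lambda>j. int (e i j)) z * character (\<lambda>j. int (e i j) - \<alpha> j) \<theta>"
  have s: "c (e i) * zpow (\<lambda>j. int (e i j)) (rot \<theta> z) * character (\<lambda>j. - \<alpha> j) \<theta> = ?s i \<theta>" for i \<theta>
    using character_mult[of "\<lambda>j. int (e i j)" \<theta> "\<lambda>j. - \<alpha> j"] by (simp add: zpow_rot mult_ac)
  have ms: "mean (?s i) = ?t i" for i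
  proof -
    have "(\<lambda>j. int (e i j) - \<alpha> j) = (\<lambda>j. 0) \<longleftrightarrow> (\<lambda>j. int (e i j)) = \<alpha>"
      by (auto simp: fun_eq_iff)
    then show ?thesis unfolding mean_cmult mean_character by auto
  qed
  have bd: "norm (c (e i) * zpow (\<lambda>j. int (e i j)) (rot \<theta> z)) \<le> b i" for i \<theta>
    by (rule b) (simp add: norm_mult)
  have sm: "summable (\<lambda>i. c (e i) * zpow (\<lambda>j. int (e i j)) (rot \<theta> z))" for \<theta>
    by (rule summable_comparison_test'[OF sb]) (use bd in auto)
  have nb: "norm ((\<Sum>i<n. ?t i) - fcoeff ?F \<alpha> z) \<le> suminf b - (\<Sum>i<n. b i)" for n
  proof -
    have "fcoeff ?F \<alpha> z - (\<Sum>i<n. ?t i) = mean (\<lambda>\<theta>. ?F (rot \<theta> z) * character (\<lambda>j. - \<alpha> j) \<theta> - (\<Sum>i<n. ?s i \<theta>))"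
      unfolding fcoeff_def
      by (subst mean_diff, (intro continuous_intros cont)+, subst mean_sum)
        (auto intro!: continuous_intros simp only: ms)
    also have "norm \<dots> \<le> suminf b - (\<Sum>i<n. b i)"
    proof (rule norm_mean_le)
      show "continuous_on UNIV (\<lambda>\<theta>. ?F (rot \<theta> z) * character (\<lambda>j. - \<alpha> j) \<theta> - (\<Sum>i<n. ?s i \<theta>))"
        by (intro continuous_intros cont)
      fix \<theta>
      have "?F (rot \<theta> z) * character (\<lambda>j. - \<alpha> j) \<theta> - (\<Sum>i<n. ?s i \<theta>) =
          (?F (rot \<theta> z) - (\<Sum>i<n. c (e i) * zpow (\<lambda>j. int (e i j)) (rot \<theta> z))) * character (\<lambda>j. - \<alpha> j) \<theta>"
        by (simp only: s[symmetric] left_diff_distrib sum_distrib_right)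
      also have "norm \<dots> = norm (\<Sum>i. c (e (i + n)) * zpow (\<lambda>j. int (e (i + n) j)) (rot \<theta> z))"
        by (simp only: suminf_minus_initial_segment[OF sm] norm_mult norm_character mult_1_right)
      also have "\<dots> \<le> (\<Sum>i. b (i + n))"
        by (intro norm_suminf_le bd summable_ignore_initial_segment sb)
      also have "\<dots> = suminf b - (\<Sum>i<n. b i)" by (rule suminf_minus_initial_segment[OF sb])
      finally show "norm (?F (rot \<theta> z) * character (\<lambda>j. - \<alpha> j) \<theta> - (\<Sum>i<n. ?s i \<theta>)) \<le> suminf b - (\<Sum>i<n. b i)" .
    qed
    finally show ?thesis by (simp only: norm_minus_commute)
  qed
  have "(\<lambda>n. suminf b - (\<Sum>i<n. b i)) \<longlonglongrightarrow> suminf b - suminf b"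
    by (intro tendsto_intros summable_LIMSEQ sb)
  then have lim: "(\<lambda>n. suminf b - (\<Sum>i<n. b i)) \<longlonglongrightarrow> 0" by simp
  have "(\<lambda>n. (\<Sum>i<n. ?t i) - fcoeff ?F \<alpha> z) \<longlonglongrightarrow> 0"
    by (rule Lim_null_comparison[OF always_eventually[OF allI[OF nb]] lim])
  then show ?thesis unfolding sums_def by (simp only: LIM_zero_iff)
qed

lemma eq_on_nonzero_imp_eq:
  fixes f F :: "complex ^ 'n \<Rightarrow> complex"
  assumes op: "open \<Omega>" and c: "continuous_on \<Omega> f" "continuous_on \<Omega> F"
    and eq: "\<And>z. z \<in> \<Omega> \<Longrightarrow> nonzero z \<Longrightarrow> F z = f z" and z: "z \<in> \<Omega>"
  shows "F z = f z"
proof (rule ccontr)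
  assume ne: "F z \<noteq> f z"
  define V where "V = \<Omega> \<inter> (\<lambda>z. F z - f z) -` (- {0})"
  have "open V" unfolding V_def
    by (rule continuous_open_preimage) (auto intro!: continuous_intros c op)
  moreover have "z \<in> V" using ne z by (simp add: V_def)
  ultimately obtain w where w: "w \<in> V" "\<And>j. cmod (z $ j) < cmod (w $ j)"
    using exists_larger_moduli[OF _ _ zero_less_one] by blast
  have "0 < cmod (w $ j)" for j using le_less_trans[OF norm_ge_zero w(2)] .
  then show False using eq[of w] w(1) by (auto simp: V_def)
qed

text \<open>Only derivatives in the directions of the real parts of the coordinates are taken: for the
  holomorphic function \<open>f\<close> they are its complex partial derivatives.  Smoothness up to the
  boundary makes them bounded near the origin.\<close>

lemma smooth_up_to_boundary_holomorphic_coefficients: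
  fixes \<Omega> :: "(complex ^ 'n) set"
  assumes R: "Reinhardt_domain \<Omega>" and 0: "0 \<in> frontier \<Omega>"
    and sm: "smooth_up_to_boundary \<Omega> f" and hol: "f holomorphic_Cn \<Omega>"
  shows "\<exists>a. (\<forall>\<alpha>. \<forall>z\<in>\<Omega>. nonzero z \<longrightarrow> fcoeff f \<alpha> z = a \<alpha> * zpow \<alpha> z) \<and>
    (\<forall>\<alpha> j. \<alpha> j < 0 \<longrightarrow> a \<alpha> = 0)"
proof -
  define G where "G js = iterated_partial (map (\<lambda>j. axis j 1) js) f" for js :: "'n list"
  have mem: "map (\<lambda>j. axis j 1) js \<in> lists (Basis :: (complex ^ 'n) set)" for js :: "'n list"
    by (induction js) (auto simp: Basis_complex_def)
  have cG: "continuous_on \<Omega> (G js)" for js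
    using sm mem[of js] unfolding G_def smooth_up_to_boundary_def smooth_on_def by blast
  have pG: "pd j (G js) = G (j # js)" for j js by (simp add: G_def)
  have sG: "sep_holo (G js) \<Omega>" for js
  proof (induction js)
    case Nil
    then show ?case using holomorphic_Cn_imp_sep_holo[OF hol] by (simp add: G_def)
  next
    case (Cons j js)
    show ?case
      using sep_holo_pd[OF Reinhardt_open[OF R] Cons, of j] cG[of "j # js"] by (simp add: pG)
  qed
  have 0: "0 \<in> closure \<Omega>" using 0 by (simp add: frontier_def)
  have bd: "\<exists>\<delta>>0. \<exists>B. \<forall>z\<in>\<Omega>. norm z < \<delta> \<longrightarrow> norm (G js z) \<le> B" for js
  proof -
    obtain g where g: "continuous_on (closure \<Omega>) g" "\<And>z. z \<in> \<Omega> \<Longrightarrow> g z = G js z"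
      using sm mem[of js] unfolding G_def smooth_up_to_boundary_def by blast
    obtain \<delta> where \<delta>: "\<delta> > 0" "\<And>z. z \<in> closure \<Omega> \<Longrightarrow> dist z 0 < \<delta> \<Longrightarrow> dist (g z) (g 0) < 1"
      using g(1) 0 unfolding continuous_on_iff by (metis zero_less_one)
    have "norm (G js z) \<le> norm (g 0) + 1" if z: "z \<in> \<Omega>" "norm z < \<delta>" for z
    proof -
      have "dist (g z) (g 0) < 1" using z closure_subset by (intro \<delta>(2)) auto
      then show ?thesis
        using g(2)[OF z(1)] norm_triangle_ineq2[of "g z" "g 0"] by (simp add: dist_norm)
    qed
    then show ?thesis using \<delta>(1) by blast
  qed
  have f: "G [] = f" by (simp add: G_def)
  have sf: "sep_holo f \<Omega>" using sG[of "[]"] by (simp add: f)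
  have cpd: "continuous_on \<Omega> (pd j f)" for j using cG[of "[j]"] pG[of j "[]"] by (simp add: f)
  have "\<exists>a. (\<forall>z\<in>\<Omega>. nonzero z \<longrightarrow> fcoeff f \<alpha> z = a * zpow \<alpha> z) \<and> (\<forall>j. \<alpha> j < 0 \<longrightarrow> a = 0)" for \<alpha>
  proof -
    obtain a where a: "\<And>z. z \<in> \<Omega> \<Longrightarrow> nonzero z \<Longrightarrow> fcoeff f \<alpha> z = a * zpow \<alpha> z"
      using fcoeff_eq_monomial[OF R sf cpd, of \<alpha>] by blast
    have "\<exists>\<delta>>0. \<exists>B. \<forall>z\<in>\<Omega>. norm z < \<delta> \<longrightarrow>
        norm (fcoeff f \<alpha> z) \<le> B * (\<Prod>j\<in>UNIV. norm (z $ j) ^ nat (\<alpha> j))"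
    proof (rule fcoeff_bound_near_0[OF R, of "range G"])
      show "f \<in> range G" by (metis f rangeI)
    qed (use sG bd pG in auto)
    then obtain \<delta> B where B: "\<delta> > 0" "\<And>z. z \<in> \<Omega> \<Longrightarrow> norm z < \<delta> \<Longrightarrow>
        norm (fcoeff f \<alpha> z) \<le> B * (\<Prod>j\<in>UNIV. norm (z $ j) ^ nat (\<alpha> j))"
      by blast
    have "a = 0" if "\<alpha> j < 0" for j
      by (rule monomial_coefficient_eq_0[where \<alpha> = \<alpha> and B = B, OF Reinhardt_open[OF R] 0 B(1) _ that])
        (metis a B(2))
    then show ?thesis using a by blast
  qed
  then show ?thesis by metis
qed

theorem mainTheorem2:
  fixes \<Omega> :: "(complex ^ 'n) set" and f :: "complex ^ 'n \<Rightarrow> complex"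
  assumes "Reinhardt_domain \<Omega>"
    and "0 \<in> frontier \<Omega>"
    and "smooth_up_to_boundary \<Omega> f"
    and "f holomorphic_Cn \<Omega>"
  shows "\<exists>F. F holomorphic_Cn (log_convex_complete_hull \<Omega>) \<and> (\<forall>z\<in>\<Omega>. F z = f z)"
proof -
  note R = assms(1)
  have cf: "continuous_on \<Omega> f"
    by (rule sep_holo_continuous[OF holomorphic_Cn_imp_sep_holo[OF assms(4)]])
  obtain a where a: "\<And>\<alpha> z. z \<in> \<Omega> \<Longrightarrow> nonzero z \<Longrightarrow> fcoeff f \<alpha> z = a \<alpha> * zpow \<alpha> z"
    and a0: "\<And>\<alpha> j. \<alpha> j < 0 \<Longrightarrow> a \<alpha> = 0"
    using smooth_up_to_boundary_holomorphic_coefficients[OF assms] by blast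
  define c where "c \<beta> = a (\<lambda>j. int (\<beta> j))" for \<beta> :: "'n \<Rightarrow> nat"
  have "infinite (UNIV :: ('n \<Rightarrow> nat) set)"
  proof -
    have "inj (\<lambda>k :: nat. \<lambda>j :: 'n. k)" by (auto simp: inj_def fun_eq_iff)
    then show ?thesis using finite_imageD infinite_UNIV_nat infinite_super by (metis subset_UNIV)
  qed
  then have "bij (from_nat_into (UNIV :: ('n \<Rightarrow> nat) set))"
    using bij_betw_from_nat_into[of "UNIV :: ('n \<Rightarrow> nat) set"] by simp
  then obtain e :: "nat \<Rightarrow> 'n \<Rightarrow> nat" where e: "bij e" by blast
  then have inj: "inj e" by (rule bij_is_inj)
  define F where "F z = (\<Sum>i. c (e i) * zpow (\<lambda>j. int (e i j)) z)" for z
  let ?L = "convex hull log_image \<Omega>"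
  have M: "\<exists>M. \<forall>\<beta>. norm (c \<beta>) * (\<Prod>j\<in>UNIV. exp (x $ j) ^ \<beta> j) \<le> M" if "x \<in> ?L" for x
  proof (rule coefficient_bound_hull[OF _ that])
    fix z assume z: "z \<in> \<Omega>" "nonzero z"
    obtain M where "\<And>\<theta>. norm (f (rot \<theta> z)) \<le> M"
      using compact_imp_bounded[OF compact_continuous_image[OF continuous_on_subset[OF cf] compact_torus[of z]]]
        Reinhardt_rot[OF R z(1)] unfolding bounded_iff by blast
    then show "\<exists>M. \<forall>\<beta>. norm (c \<beta> * zpow (\<lambda>j. int (\<beta> j)) z) \<le> M"
      unfolding c_def using a[OF z] norm_fcoeff_le[OF R cf z(1)] by metis
  qed
  have hull: "log_convex_complete_hull \<Omega> = {z. \<exists>x\<in>?L. \<forall>j. cmod (z $ j) < exp (x $ j)}"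
    by (rule log_convex_complete_hull_eq[OF R])
  have hol: "F holomorphic_Cn (log_convex_complete_hull \<Omega>)"
    unfolding hull F_def[abs_def] by (rule power_series_holomorphic[OF inj M])
  have sub: "\<Omega> \<subseteq> log_convex_complete_hull \<Omega>" unfolding hull by (rule subset_hull_polydiscs[OF Reinhardt_open[OF R]])
  have cF: "continuous_on \<Omega> F"
    using sep_holo_continuous[OF holomorphic_Cn_imp_sep_holo[OF hol]] sub by (rule continuous_on_subset)
  have "F z = f z" if z: "z \<in> \<Omega>" "nonzero z" for z
  proof -
    have "fcoeff F \<alpha> z = fcoeff f \<alpha> z" for \<alpha>
    proof -
      obtain x where x: "x \<in> ?L" "\<And>j. cmod (z $ j) < exp (x $ j)" using sub z(1) unfolding hull by blast
      obtain \<rho> where \<rho>: "0 < \<rho>" "\<rho> < 1" "\<And>j. norm (z $ j) < \<rho> * exp (x $ j)"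
        using polydisc_between[of z "\<lambda>j. exp (x $ j)", OF x(2)] by blast
      obtain M where "\<And>\<beta>. norm (c \<beta>) * (\<Prod>j\<in>UNIV. exp (x $ j) ^ \<beta> j) \<le> M" using M[OF x(1)] by blast
      from power_series_majorant[where R = "\<lambda>j. exp (x $ j)", OF inj \<rho>(1,2) exp_gt_zero this]
      obtain b where b: "summable b" "\<And>i z. (\<forall>j. norm (z $ j) \<le> \<rho> * exp (x $ j)) \<Longrightarrow>
        norm (c (e i) * zpow (\<lambda>j. int (e i j)) z) \<le> b i" by blast
      have s: "(\<lambda>i. if (\<lambda>j. int (e i j)) = \<alpha> then c (e i) * zpow \<alpha> z else 0) sums fcoeff F \<alpha> z"
        unfolding F_def[abs_def]
      proof (rule fcoeff_power_series[OF inj b(1)])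
        show "continuous_on UNIV (\<lambda>\<theta>. \<Sum>i. c (e i) * zpow (\<lambda>j. int (e i j)) (rot \<theta> z))"
          using continuous_on_fcoeff_integrand[OF R cF z(1)] by (simp add: F_def[abs_def])
      qed (use b(2) \<rho>(3) in \<open>auto simp: less_imp_le\<close>)
      show ?thesis
      proof (cases "\<exists>j. \<alpha> j < 0")
        case True
        then have "(\<lambda>j. int (e i j)) \<noteq> \<alpha>" for i by auto
        then have "fcoeff F \<alpha> z = 0" using s sums_unique2[OF _ sums_zero] by simp
        then show ?thesis using a[OF z] a0 True by auto
      next
        case False
        define \<beta> where "\<beta> j = nat (\<alpha> j)" for j
        have \<alpha>: "\<alpha> = (\<lambda>j. int (\<beta> j))" using False by (auto simp: \<beta>_def fun_eq_iff not_less)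
        \<comment> \<open>surjectivity of the enumeration: no coefficient is lost\<close>
        obtain k where k: "e k = \<beta>" using e by (metis bij_pointE)
        have "(\<lambda>i. if (\<lambda>j. int (e i j)) = \<alpha> then c (e i) * zpow \<alpha> z else 0)
            = (\<lambda>i. if i = k then c (e i) * zpow \<alpha> z else 0)"
          using inj by (auto simp: \<alpha> k[symmetric] fun_eq_iff inj_def)
        then have "(\<lambda>i. if i = k then c (e i) * zpow \<alpha> z else 0) sums fcoeff F \<alpha> z" using s by simp
        from sums_unique2[OF this sums_single[of k "\<lambda>i. c (e i) * zpow \<alpha> z"]]
        have "fcoeff F \<alpha> z = c (e k) * zpow \<alpha> z" .
        then show ?thesis using a[OF z] by (simp add: k c_def \<alpha>)
      qed
    qed
    have "F z - f z = 0"
    proof (rule fourier_uniqueness)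
      show "continuous_on (range (\<lambda>\<theta>. rot \<theta> z)) (\<lambda>w. F w - f w)"
        using Reinhardt_rot[OF R z(1)]
        by (intro continuous_intros continuous_on_subset[OF cF] continuous_on_subset[OF cf]) auto
      fix \<gamma>
      have "mean (\<lambda>\<theta>. F (rot \<theta> z) * character \<gamma> \<theta> - f (rot \<theta> z) * character \<gamma> \<theta>)
          = fcoeff F (\<lambda>j. - \<gamma> j) z - fcoeff f (\<lambda>j. - \<gamma> j) z"
        unfolding fcoeff_def
        by (subst mean_diff) (auto intro!: continuous_intros continuous_on_fcoeff_integrand[OF R _ z(1)] cF cf)
      then show "mean (\<lambda>\<theta>. (F (rot \<theta> z) - f (rot \<theta> z)) * character \<gamma> \<theta>) = 0"
        using \<open>\<And>\<alpha>. fcoeff F \<alpha> z = fcoeff f \<alpha> z\<close> by (simp add: left_diff_distrib)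
    qed
    then show ?thesis by simp
  qed
  then have "\<forall>z\<in>\<Omega>. F z = f z"
    using eq_on_nonzero_imp_eq[OF Reinhardt_open[OF R] cf cF] by blast
  then show ?thesis using hol by blast
qed

end
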